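(* Let $1 \leq \delta \leq 2$. There are absolute constants $\alpha>1$ and $c>0$ with the following properties. (i) For every $n \in \mathbb{N}$ and every finite family $\{C_i : i\in I\}$ of convex bodies in $\mathbb{R}^n$ such that $\bigcap_{i\in I}C_i$ has non-empty interior, there are $z\in \mathbb{R}^n$, a number $s\leq \alpha n^{\delta}$ and indices $i_1,\ldots, i_s\in I$ such that $$z+\left(C_{i_1} \cap \dots \cap C_{i_s}\right) \subset c\, n^{2-\frac{\delta}{2}} \left( z + \bigcap_{i\in I}C_i \right).$$ (ii) In particular, for every $n \in \mathbb{N}$ and every finite family $\{C_i : i\in I\}$ of convex bodies in $\mathbb{R}^n$ with $\operatorname{diam}\left(\bigcap_{i\in I}C_i\right)=1$, there exist $s\leq \alpha n^{\delta}$ and indices $i_1,\ldots, i_s\in I$ such that $$\operatorname{diam}(C_{i_1}\cap\cdots\cap C_{i_s})\leq c\, n^{2-\frac{\delta}{2}}.$$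
   Context: A convex body in $\mathbb{R}^n$ is a compact convex subset of $\mathbb{R}^n$ with non-empty interior. $\operatorname{diam}$ denotes the diameter with respect to the Euclidean norm. "Absolute constant" means that $\alpha$ and $c$ do not depend on $n$, $\delta$, or the family of convex bodies. For $\lambda>0$, $z\in\mathbb{R}^n$ and a set $A\subset\mathbb{R}^n$, $z+A=\{z+a: a\in A\}$ and $\lambda A=\{\lambda a : a\in A\}$. *)

theory Defs
  imports "HOL-Analysis.Analysis"
begin

text \<open>
  The dimension is quantified inside the scope of the absolute constants, so it cannot be a
  type. Points of the \<open>n\<close>-dimensional space are therefore the elements of
  \<^term>\<open>topspace (Euclidean_space n)\<close>, that is, functions \<^typ>\<open>nat \<Rightarrow> real\<close> vanishing at all
  indices \<open>i \<ge> n\<close>, with the topology \<^term>\<open>Euclidean_space n\<close>.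
\<close>

definition translate :: "(nat \<Rightarrow> real) \<Rightarrow> (nat \<Rightarrow> real) set \<Rightarrow> (nat \<Rightarrow> real) set"
  where "translate z A = (\<lambda>a i. z i + a i) ` A"

definition dilate :: "real \<Rightarrow> (nat \<Rightarrow> real) set \<Rightarrow> (nat \<Rightarrow> real) set"
  where "dilate r A = (\<lambda>a i. r * a i) ` A"

definition convex_fun :: "(nat \<Rightarrow> real) set \<Rightarrow> bool"
  where "convex_fun A \<longleftrightarrow>
    (\<forall>x\<in>A. \<forall>y\<in>A. \<forall>u\<ge>0. \<forall>v\<ge>0. u + v = 1 \<longrightarrow> (\<lambda>i. u * x i + v * y i) \<in> A)"

definition convex_body :: "nat \<Rightarrow> (nat \<Rightarrow> real) set \<Rightarrow> bool"
  where "convex_body n A \<longleftrightarrow>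
    compactin (Euclidean_space n) A \<and> convex_fun A \<and> Euclidean_space n interior_of A \<noteq> {}"

text \<open>
  The library constant \<^const>\<open>diameter\<close> is not usable here: on \<^typ>\<open>nat \<Rightarrow> real\<close> it refers to the
  product metric of \<^theory>\<open>HOL-Analysis.Function_Metric\<close>, which is not Euclidean. As for
  \<^const>\<open>diameter\<close>, the value is meaningful only for bounded sets.
\<close>

definition eucl_dist :: "nat \<Rightarrow> (nat \<Rightarrow> real) \<Rightarrow> (nat \<Rightarrow> real) \<Rightarrow> real"
  where "eucl_dist n x y = sqrt (\<Sum>i<n. (x i - y i)\<^sup>2)"

definition eucl_diam :: "nat \<Rightarrow> (nat \<Rightarrow> real) set \<Rightarrow> real"
  where "eucl_diam n A = (if A = {} then 0 else SUP (x, y)\<in>A \<times> A. eucl_dist n x y)"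

end

theory Submission
  imports Defs
begin

text \<open>
  Replace the family by finitely many half-spaces, each strictly containing some \<open>C\<^sub>i\<close>, whose
  intersection \<open>Q\<close> contains \<open>\<Inter>C\<^sub>i\<close> and lies in a small neighbourhood of it. Maximising a
  logarithmic barrier over the ellipsoids \<open>z + T B\<close> in \<open>Q\<close>, with \<open>T\<close> lower triangular, puts \<open>Q\<close> into
  an approximate John position: after the affine change of variables the half-spaces are
  \<open>\<langle>x, u\<^sub>j\<rangle> \<le> 1\<close> with \<open>|u\<^sub>j| \<le> 1\<close>, and the first-order conditions are
  \<open>\<Sum>w\<^sub>j u\<^sub>j u\<^sub>j\<^sup>T = I\<close>, \<open>\<Sum>w\<^sub>j u\<^sub>j = 0\<close>, \<open>\<Sum>w\<^sub>j = 2n\<close>.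

  A one-sided Batson--Spielman--Srivastava argument then picks \<open>s\<close> of the \<open>u\<^sub>j\<close> with weights of
  total mass \<open>O(n)\<close> whose second moment dominates \<open>I\<close> and whose first moment \<open>y\<close> has norm
  \<open>O(n / \<surd>s)\<close>; the lower barrier potential and \<open>|y|\<^sup>2\<close> are controlled together, by averaging over
  the choice of the next vector. Since \<open>-y = \<Sum>w\<^sub>j (|y| - \<langle>y, u\<^sub>j\<rangle>) u\<^sub>j\<close>, Caratheodory's theorem
  cancels the first moment with \<open>n + 1\<close> more vectors of total mass \<open>2n|y|\<close>. For a point \<open>x\<close> of the
  selected half-spaces, summing \<open>(1 - \<langle>x, u\<^sub>j\<rangle>) (|x| + \<langle>x, u\<^sub>j\<rangle>) \<ge> 0\<close> bounds \<open>|x|\<close> by the total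
  mass \<open>O(n + n\<^sup>2 / \<surd>s)\<close>, and \<open>s\<close> of order \<open>n\<^sup>\<delta>\<close> gives the theorem.
\<close>

section \<open>Linear systems and positive semidefinite matrices\<close>

text \<open>Gaussian elimination by induction on the number of equations: the last one is solved for
  a pivot unknown and substituted into the others.\<close>

lemma homogeneous_system_nontrivial:
  fixes A :: "nat \<Rightarrow> 'b \<Rightarrow> real"
  assumes "finite J" "n < card J"
  shows "\<exists>x. (\<exists>j\<in>J. x j \<noteq> 0) \<and> (\<forall>i<n. (\<Sum>j\<in>J. A i j * x j) = 0)"
  using assms
proof (induction n arbitrary: J A)
  case 0
  then have "J \<noteq> {}" by auto
  then show ?case by (intro exI[of _ "\<lambda>_. 1"]) auto
next
  case (Suc n)
  show ?case
  proof (cases "\<forall>j\<in>J. A n j = 0")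
    case True
    obtain x where x: "\<exists>j\<in>J. x j \<noteq> 0" "\<forall>i<n. (\<Sum>j\<in>J. A i j * x j) = 0"
      using Suc.IH[of J A] Suc.prems by auto
    have "(\<Sum>j\<in>J. A n j * x j) = 0" using True by simp
    then show ?thesis using x by (auto simp: less_Suc_eq)
  next
    case False
    then obtain p where p: "p \<in> J" "A n p \<noteq> 0" by auto
    let ?J = "J - {p}"
    \<comment> \<open>The coefficient matrix after the unknown \<open>p\<close> has been eliminated
      by means of row \<open>n\<close>.\<close>
    let ?B = "\<lambda>i j. A i j - A i p * A n j / A n p"
    have "n < card ?J" using Suc.prems p by simp
    then obtain x where x: "\<exists>j\<in>?J. x j \<noteq> 0" "\<And>i. i < n \<Longrightarrow> (\<Sum>j\<in>?J. ?B i j * x j) = 0"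
      using Suc.IH[of ?J ?B] Suc.prems by blast
    define y where "y = x(p := - (\<Sum>j\<in>?J. A n j * x j) / A n p)"
    have split: "(\<Sum>j\<in>J. A i j * y j) = A i p * y p + (\<Sum>j\<in>?J. A i j * x j)" for i
    proof -
      have "(\<Sum>j\<in>J. A i j * y j) = A i p * y p + (\<Sum>j\<in>?J. A i j * y j)"
        using p Suc.prems by (simp add: sum.remove)
      also have "(\<Sum>j\<in>?J. A i j * y j) = (\<Sum>j\<in>?J. A i j * x j)"
        by (rule sum.cong) (auto simp: y_def)
      finally show ?thesis .
    qed
    have "(\<Sum>j\<in>J. A i j * y j) = 0" if "i < Suc n" for i
    proof (cases "i = n")
      case True
      then show ?thesis using p by (simp only: split) (simp add: y_def)
    next
      case False
      then have "i < n" using that by simp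
      have "(\<Sum>j\<in>?J. ?B i j * x j) =
          (\<Sum>j\<in>?J. A i j * x j) - A i p / A n p * (\<Sum>j\<in>?J. A n j * x j)"
        by (simp add: sum_distrib_left sum_subtractf[symmetric] algebra_simps)
      then show ?thesis
        using x(2)[OF \<open>i < n\<close>] unfolding split by (simp add: y_def)
    qed
    moreover have "\<exists>j\<in>J. y j \<noteq> 0" using x(1) by (auto simp: y_def)
    ultimately show ?thesis by blast
  qed
qed

text \<open>With more than \<open>n + 1\<close> indices the vectors have an affine dependence
  \<open>x\<close>. Moving the weights along \<open>x\<close> keeps mass and moment; the move stops
  when a first weight reaches zero, which removes an index.\<close>

lemma caratheodory_weights:
  fixes u :: "'b \<Rightarrow> nat \<Rightarrow> real"
  assumes "finite J" "\<And>j. j \<in> J \<Longrightarrow> 0 \<le> e j"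
  shows "\<exists>K f. K \<subseteq> J \<and> card K \<le> Suc n \<and> (\<forall>j\<in>K. 0 \<le> f j) \<and> sum f K = sum e J \<and>
    (\<forall>i<n. (\<Sum>j\<in>K. f j * u j i) = (\<Sum>j\<in>J. e j * u j i))"
  using assms
proof (induction "card J" arbitrary: J e rule: less_induct)
  case less
  show ?case
  proof (cases "card J \<le> Suc n")
    case True
    then show ?thesis using less.prems by blast
  next
    case False
    \<comment> \<open>The row of ones at index \<open>n\<close> makes the coefficients of the
      dependence sum to zero, so that the mass is preserved.\<close>
    then obtain x where x: "\<exists>j\<in>J. x j \<noteq> 0"
      and x0: "\<And>i. i < Suc n \<Longrightarrow> (\<Sum>j\<in>J. (if i < n then u j i else 1) * x j) = 0"
      using homogeneous_system_nontrivial[of J "Suc n" "\<lambda>i j. if i < n then u j i else 1"]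
        less.prems by force
    have xn: "sum x J = 0" using x0[of n] by simp
    have xi: "(\<Sum>j\<in>J. x j * u j i) = 0" if "i < n" for i
      using x0[of i] that by (simp add: mult.commute)
    let ?N = "{j \<in> J. x j < 0}"
    have "?N \<noteq> {}"
    proof
      assume "?N = {}"
      then have "\<forall>j\<in>J. 0 \<le> x j" by force
      then have "\<forall>j\<in>J. x j = 0" using xn less.prems(1) by (simp add: sum_nonneg_eq_0_iff)
      then show False using x by blast
    qed
    moreover have fN: "finite ?N" using less.prems by auto
    ultimately obtain p where p: "p \<in> ?N"
      and pmin: "\<And>j. j \<in> ?N \<Longrightarrow> e p / (- x p) \<le> e j / (- x j)"
      using ex_is_arg_min_if_finite[OF fN, of "\<lambda>j. e j / (- x j)"]
      by (auto simp: is_arg_min_linorder)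
    \<comment> \<open>The longest step along \<open>x\<close> that keeps every weight nonnegative;
      it annihilates the weight of \<open>p\<close>.\<close>
    define r where "r = e p / (- x p)"
    define g where "g j = e j + r * x j" for j
    have r0: "0 \<le> r" using p less.prems(2) by (auto simp: r_def divide_nonneg_neg)
    have gp: "g p = 0" using p by (simp add: g_def r_def field_simps)
    have g0: "0 \<le> g j" if "j \<in> J" for j
    proof (cases "x j < 0")
      case True
      then have "r \<le> e j / (- x j)" using pmin that by (simp add: r_def)
      then have "r * (- x j) \<le> e j" using True by (simp add: field_simps)
      then show ?thesis by (simp add: g_def)
    next
      case False
      then show ?thesis using r0 less.prems(2)[OF that] by (simp add: g_def)
    qed
    let ?J = "J - {p}"
    have "card ?J < card J" using p less.prems(1) by (intro card_Diff1_less) auto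
    moreover have "finite ?J" using less.prems by simp
    ultimately obtain K f where K: "K \<subseteq> ?J" "card K \<le> Suc n" "\<forall>j\<in>K. 0 \<le> f j"
      "sum f K = sum g ?J" "\<forall>i<n. (\<Sum>j\<in>K. f j * u j i) = (\<Sum>j\<in>?J. g j * u j i)"
      using less.hyps[of ?J g] g0 by blast
    have "sum g ?J = sum g J" using p less.prems(1) gp by (simp add: sum_diff1)
    also have "\<dots> = sum e J"
      using xn by (simp add: g_def sum.distrib sum_distrib_left[symmetric])
    finally have 1: "sum g ?J = sum e J" .
    have 2: "(\<Sum>j\<in>?J. g j * u j i) = (\<Sum>j\<in>J. e j * u j i)" if "i < n" for i
    proof -
      have "(\<Sum>j\<in>?J. g j * u j i) = (\<Sum>j\<in>J. g j * u j i)"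
        using p less.prems(1) gp by (simp add: sum_diff1)
      also have "\<dots> = (\<Sum>j\<in>J. e j * u j i) + r * (\<Sum>j\<in>J. x j * u j i)"
        by (simp add: g_def algebra_simps sum.distrib sum_distrib_left)
      finally show ?thesis using xi[OF that] by simp
    qed
    show ?thesis using K 1 2 by (intro exI[of _ K] exI[of _ f]) auto
  qed
qed

section \<open>Inner products, matrices and positive semidefinite forms on the first
  \<open>n\<close> coordinates\<close>

definition ip :: "nat \<Rightarrow> (nat \<Rightarrow> real) \<Rightarrow> (nat \<Rightarrow> real) \<Rightarrow> real"
  where "ip n x y = (\<Sum>i<n. x i * y i)"

definition mv :: "nat \<Rightarrow> (nat \<Rightarrow> nat \<Rightarrow> real) \<Rightarrow> (nat \<Rightarrow> real) \<Rightarrow> nat \<Rightarrow> real"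
  where "mv n M x = (\<lambda>i. \<Sum>j<n. M i j * x j)"

definition tr :: "nat \<Rightarrow> (nat \<Rightarrow> nat \<Rightarrow> real) \<Rightarrow> real"
  where "tr n M = (\<Sum>i<n. M i i)"

text \<open>The trace of the product \<open>M N\<close> when \<open>N\<close> is symmetric.\<close>

definition frob :: "nat \<Rightarrow> (nat \<Rightarrow> nat \<Rightarrow> real) \<Rightarrow> (nat \<Rightarrow> nat \<Rightarrow> real) \<Rightarrow> real"
  where "frob n M N = (\<Sum>i<n. \<Sum>j<n. M i j * N i j)"

definition sym_mat :: "nat \<Rightarrow> (nat \<Rightarrow> nat \<Rightarrow> real) \<Rightarrow> bool"
  where "sym_mat n M \<longleftrightarrow> (\<forall>i<n. \<forall>j<n. M i j = M j i)"

definition psd :: "nat \<Rightarrow> (nat \<Rightarrow> nat \<Rightarrow> real) \<Rightarrow> bool"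
  where "psd n M \<longleftrightarrow> sym_mat n M \<and> (\<forall>x. 0 \<le> ip n x (mv n M x))"

lemma ip_commute: "ip n x y = ip n y x"
  by (simp add: ip_def mult.commute)

lemma ip_cong: "(\<And>i. i < n \<Longrightarrow> x i = x' i) \<Longrightarrow> (\<And>i. i < n \<Longrightarrow> y i = y' i) \<Longrightarrow> ip n x y = ip n x' y'"
  by (simp add: ip_def)

lemma ip_self_nonneg [simp]: "0 \<le> ip n x x"
  by (simp add: ip_def sum_nonneg)

lemma ip_self_eq_0: "ip n x x = 0 \<longleftrightarrow> (\<forall>i<n. x i = 0)"
  by (simp add: ip_def sum_nonneg_eq_0_iff Ball_def)

lemma ip_add_right: "ip n x (\<lambda>i. y i + z i) = ip n x y + ip n x z"
  by (simp add: ip_def algebra_simps sum.distrib)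

lemma ip_diff_right: "ip n x (\<lambda>i. y i - z i) = ip n x y - ip n x z"
  by (simp add: ip_def algebra_simps sum_subtractf)

lemma ip_scale_right: "ip n x (\<lambda>i. c * y i) = c * ip n x y"
  by (simp add: ip_def algebra_simps sum_distrib_left)

lemma ip_add_left: "ip n (\<lambda>i. y i + z i) x = ip n y x + ip n z x"
  by (simp add: ip_def algebra_simps sum.distrib)

lemma ip_diff_left: "ip n (\<lambda>i. y i - z i) x = ip n y x - ip n z x"
  by (simp add: ip_def algebra_simps sum_subtractf)

lemma ip_scale_left: "ip n (\<lambda>i. c * y i) x = c * ip n y x"
  by (simp add: ip_def algebra_simps sum_distrib_left)

lemmas ip_linear = ip_add_right ip_diff_right ip_scale_right ip_add_left ip_diff_left ip_scale_left

lemma ip_sum_right: "ip n x (\<lambda>i. \<Sum>j\<in>J. c j * u j i) = (\<Sum>j\<in>J. c j * ip n x (u j))"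
  unfolding ip_def sum_distrib_left
  by (subst sum.swap) (simp add: algebra_simps)

lemma ip_sum_left: "ip n (\<lambda>i. \<Sum>j\<in>J. c j * u j i) x = (\<Sum>j\<in>J. c j * ip n (u j) x)"
  using ip_sum_right[of n x] by (simp add: ip_commute)

lemma ip_Cauchy_Schwarz: "(ip n x y)\<^sup>2 \<le> ip n x x * ip n y y"
  unfolding ip_def using Cauchy_Schwarz_ineq_sum[of x y "{..<n}"] by (simp add: power2_eq_square)

lemma ip_le_sqrt: "\<bar>ip n x y\<bar> \<le> sqrt (ip n x x) * sqrt (ip n y y)"
  using real_sqrt_le_mono[OF ip_Cauchy_Schwarz[of n x y]] by (simp add: real_sqrt_mult)

lemma mv_add: "mv n M (\<lambda>i. x i + y i) i = mv n M x i + mv n M y i"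
  by (simp add: mv_def algebra_simps sum.distrib)

lemma mv_diff: "mv n M (\<lambda>i. x i - y i) i = mv n M x i - mv n M y i"
  by (simp add: mv_def algebra_simps sum_subtractf)

lemma mv_scale: "mv n M (\<lambda>i. c * x i) i = c * mv n M x i"
  by (simp add: mv_def algebra_simps sum_distrib_left)

lemma mv_cong: "(\<And>i. i < n \<Longrightarrow> x i = y i) \<Longrightarrow> mv n M x = mv n M y"
  by (simp add: mv_def)

lemma sym_mat_ip:
  assumes "sym_mat n M"
  shows "ip n x (mv n M y) = ip n (mv n M x) y"
proof -
  have "ip n x (mv n M y) = (\<Sum>i<n. \<Sum>j<n. x i * M i j * y j)"
    by (simp add: ip_def mv_def sum_distrib_left algebra_simps)
  also have "\<dots> = (\<Sum>j<n. \<Sum>i<n. x i * M i j * y j)" by (rule sum.swap)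
  also have "\<dots> = (\<Sum>j<n. \<Sum>i<n. M j i * x i * y j)"
    using assms by (intro sum.cong refl) (auto simp: sym_mat_def)
  also have "\<dots> = ip n (mv n M x) y"
    by (simp add: ip_def mv_def sum_distrib_right)
  finally show ?thesis .
qed

text \<open>The form at \<open>x + t y\<close> is a nonnegative quadratic in \<open>t\<close>. Its
  value at the minimiser gives the inequality; if the leading coefficient vanishes, so must the
  linear one.\<close>

lemma psd_Cauchy_Schwarz:
  assumes "psd n M"
  shows "(ip n x (mv n M y))\<^sup>2 \<le> ip n x (mv n M x) * ip n y (mv n M y)"
proof -
  let ?a = "ip n x (mv n M x)" and ?b = "ip n x (mv n M y)" and ?c = "ip n y (mv n M y)"
  have s: "sym_mat n M" and p: "\<And>x. 0 \<le> ip n x (mv n M x)" using assms by (auto simp: psd_def)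
  have yx: "ip n y (mv n M x) = ?b" using sym_mat_ip[OF s] by (simp add: ip_commute)
  have q: "0 \<le> ?a + 2 * t * ?b + t\<^sup>2 * ?c" for t
  proof -
    have e: "mv n M (\<lambda>i. x i + t * y i) = (\<lambda>i. mv n M x i + t * mv n M y i)"
      by (rule ext) (simp add: mv_add mv_scale)
    show ?thesis
      using p[of "\<lambda>i. x i + t * y i"] unfolding e
      by (simp add: ip_linear yx power2_eq_square algebra_simps)
  qed
  show ?thesis
  proof (cases "?c = 0")
    case True
    have "?b = 0"
    proof (rule ccontr)
      assume "?b \<noteq> 0"
      moreover define t where "t = - (?a + 1) / ?b"
      ultimately have "t * ?b = - (?a + 1)" by simp
      then show False using q[of t] True p[of x] by simp
    qed
    then show ?thesis using p[of x] p[of y] by simp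
  next
    case False
    then have c: "?c > 0" using p[of y] by simp
    show ?thesis
      using mult_right_mono[OF q[of "- ?b / ?c"], of ?c] c
      by (simp add: field_simps power2_eq_square)
  qed
qed

definition unit_vec :: "nat \<Rightarrow> nat \<Rightarrow> real"
  where "unit_vec i = (\<lambda>j. if j = i then 1 else 0)"

lemma mv_unit_vec: "j < n \<Longrightarrow> mv n M (unit_vec j) i = M i j"
  by (simp add: mv_def unit_vec_def if_distrib cong: if_cong)

lemma ip_unit_vec: "i < n \<Longrightarrow> ip n (unit_vec i) x = x i"
  by (simp add: ip_def unit_vec_def if_distrib[of "\<lambda>c. c * _"] cong: if_cong)

lemma psd_entries:
  assumes "psd n M" "i < n" "j < n"
  shows "(M i j)\<^sup>2 \<le> M i i * M j j"
  using psd_Cauchy_Schwarz[OF assms(1), of "unit_vec i" "unit_vec j"] assms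
  by (simp add: ip_unit_vec mv_unit_vec)

lemma psd_diag: "psd n M \<Longrightarrow> i < n \<Longrightarrow> 0 \<le> M i i"
  unfolding psd_def using ip_unit_vec[of i n "mv n M (unit_vec i)"] by (metis mv_unit_vec)

lemma psd_tr: "psd n M \<Longrightarrow> 0 \<le> tr n M"
  unfolding tr_def by (rule sum_nonneg) (auto intro: psd_diag)

lemma psd_abs_entry:
  assumes "psd n M" "i < n" "j < n"
  shows "\<bar>M i j\<bar> \<le> sqrt (M i i) * sqrt (M j j)"
  using real_sqrt_le_mono[OF psd_entries[OF assms]] by (simp add: real_sqrt_mult)

text \<open>A bound on the largest eigenvalue without spectral theory: the entries are dominated by
  the products \<open>sqrt (M i i) * sqrt (M j j)\<close>, and Cauchy-Schwarz applies to the vector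
  of diagonal roots.\<close>

lemma psd_form_le_tr:
  assumes "psd n M"
  shows "ip n x (mv n M x) \<le> tr n M * ip n x x"
proof -
  have "ip n x (mv n M x) = (\<Sum>i<n. \<Sum>j<n. x i * M i j * x j)"
    by (simp add: ip_def mv_def sum_distrib_left algebra_simps)
  also have "\<dots> \<le> (\<Sum>i<n. \<Sum>j<n. (sqrt (M i i) * \<bar>x i\<bar>) * (sqrt (M j j) * \<bar>x j\<bar>))"
  proof (intro sum_mono)
    fix i j assume "i \<in> {..<n}" "j \<in> {..<n}"
    then have "\<bar>M i j\<bar> \<le> sqrt (M i i) * sqrt (M j j)" using psd_abs_entry[OF assms] by auto
    then have "\<bar>M i j\<bar> * (\<bar>x i\<bar> * \<bar>x j\<bar>) \<le> sqrt (M i i) * sqrt (M j j) * (\<bar>x i\<bar> * \<bar>x j\<bar>)"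
      by (intro mult_right_mono) auto
    moreover have "x i * M i j * x j \<le> \<bar>M i j\<bar> * (\<bar>x i\<bar> * \<bar>x j\<bar>)"
      by (metis abs_ge_self abs_mult mult.assoc mult.left_commute)
    ultimately show "x i * M i j * x j \<le> (sqrt (M i i) * \<bar>x i\<bar>) * (sqrt (M j j) * \<bar>x j\<bar>)"
      by (simp add: algebra_simps)
  qed
  also have "\<dots> = (ip n (\<lambda>i. sqrt (M i i)) (\<lambda>i. \<bar>x i\<bar>))\<^sup>2"
    by (simp add: ip_def power2_eq_square sum_product)
  also have "\<dots> \<le> ip n (\<lambda>i. sqrt (M i i)) (\<lambda>i. sqrt (M i i)) * ip n (\<lambda>i. \<bar>x i\<bar>) (\<lambda>i. \<bar>x i\<bar>)"
    by (rule ip_Cauchy_Schwarz)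
  also have "\<dots> = tr n M * ip n x x"
    using psd_diag[OF assms] by (simp add: ip_def tr_def)
  finally show ?thesis .
qed

text \<open>The same domination by diagonal roots, applied to both matrices.\<close>

lemma psd_frob_le:
  assumes "psd n M" "psd n N"
  shows "frob n M N \<le> tr n M * tr n N"
proof -
  have "frob n M N \<le> (\<Sum>i<n. \<Sum>j<n. (sqrt (M i i) * sqrt (N i i)) * (sqrt (M j j) * sqrt (N j j)))"
    unfolding frob_def
  proof (intro sum_mono)
    fix i j assume "i \<in> {..<n}" "j \<in> {..<n}"
    then have "\<bar>M i j\<bar> \<le> sqrt (M i i) * sqrt (M j j)" "\<bar>N i j\<bar> \<le> sqrt (N i i) * sqrt (N j j)"
      using psd_abs_entry[OF assms(1)] psd_abs_entry[OF assms(2)] by auto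
    then have "\<bar>M i j\<bar> * \<bar>N i j\<bar> \<le> (sqrt (M i i) * sqrt (M j j)) * (sqrt (N i i) * sqrt (N j j))"
      by (intro mult_mono) auto
    moreover have "M i j * N i j \<le> \<bar>M i j\<bar> * \<bar>N i j\<bar>"
      by (metis abs_ge_self abs_mult)
    ultimately show "M i j * N i j \<le> (sqrt (M i i) * sqrt (N i i)) * (sqrt (M j j) * sqrt (N j j))"
      by (simp add: algebra_simps)
  qed
  also have "\<dots> = (ip n (\<lambda>i. sqrt (M i i)) (\<lambda>i. sqrt (N i i)))\<^sup>2"
    by (simp add: ip_def power2_eq_square sum_product)
  also have "\<dots> \<le> ip n (\<lambda>i. sqrt (M i i)) (\<lambda>i. sqrt (M i i)) * ip n (\<lambda>i. sqrt (N i i)) (\<lambda>i. sqrt (N i i))"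
    by (rule ip_Cauchy_Schwarz)
  also have "\<dots> = tr n M * tr n N"
    using psd_diag[OF assms(1)] psd_diag[OF assms(2)] by (simp add: ip_def tr_def)
  finally show ?thesis .
qed

text \<open>In operator form, \<open>M^2\<close> is at most \<open>tr n M\<close> times
  \<open>M\<close>. Cauchy-Schwarz for the form \<open>M\<close> at \<open>M x\<close> and
  \<open>x\<close> has the square of \<open>?q\<close> on the left, and one factor \<open>?q\<close>
  cancels.\<close>

lemma psd_square_le:
  assumes "psd n M"
  shows "ip n (mv n M x) (mv n M x) \<le> tr n M * ip n x (mv n M x)"
proof -
  let ?y = "mv n M x"
  let ?q = "ip n ?y ?y"
  have s: "sym_mat n M" and p: "0 \<le> ip n x ?y" using assms by (auto simp: psd_def)
  have "?q\<^sup>2 \<le> ip n ?y (mv n M ?y) * ip n x ?y"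
    using psd_Cauchy_Schwarz[OF assms, of ?y x] by simp
  also have "\<dots> \<le> tr n M * ?q * ip n x ?y"
    by (rule mult_right_mono[OF psd_form_le_tr[OF assms] p])
  finally have h: "?q * ?q \<le> (tr n M * ip n x ?y) * ?q" by (simp add: power2_eq_square algebra_simps)
  show ?thesis
  proof (cases "?q = 0")
    case True
    then show ?thesis using psd_tr[OF assms] p by simp
  next
    case False
    then have "?q > 0" using ip_self_nonneg[of n ?y] by linarith
    then show ?thesis using h by simp
  qed
qed

section \<open>Resolvents and rank-one updates\<close>

text \<open>Appending \<open>- e\<close> as a column gives \<open>n\<close> homogeneous equations in
  \<open>n + 1\<close> unknowns. Injectivity forces the last unknown of a nontrivial solution to be
  nonzero, and dividing by it solves the system.\<close>

lemma injective_imp_surjective: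
  assumes inj: "\<And>x. (\<And>i. i < n \<Longrightarrow> mv n G x i = 0) \<Longrightarrow> (\<And>i. i < n \<Longrightarrow> x i = 0)"
  shows "\<exists>x. \<forall>i<n. mv n G x i = e i"
proof -
  let ?A = "\<lambda>i j. if j < n then G i j else - e i"
  obtain x where x: "\<exists>j\<in>{..n}. x j \<noteq> 0" "\<And>i. i < n \<Longrightarrow> (\<Sum>j\<in>{..n}. ?A i j * x j) = 0"
    using homogeneous_system_nontrivial[of "{..n}" n ?A] by auto
  have e: "mv n G x i = e i * x n" if "i < n" for i
  proof -
    have "(\<Sum>j\<in>{..n}. ?A i j * x j) = (\<Sum>j<n. ?A i j * x j) + ?A i n * x n"
      by (simp flip: lessThan_Suc_atMost)
    also have "(\<Sum>j<n. ?A i j * x j) = mv n G x i" by (simp add: mv_def)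
    finally show ?thesis using x(2)[OF that] by simp
  qed
  have xn: "x n \<noteq> 0"
  proof
    assume "x n = 0"
    then have "x i = 0" if "i < n" for i using inj[of x] e that by simp
    then show False using x(1) \<open>x n = 0\<close> by (metis atMost_iff le_neq_implies_less)
  qed
  show ?thesis
  proof (intro exI allI impI)
    fix i assume "i < n"
    have "mv n G (\<lambda>j. (1 / x n) * x j) i = (1 / x n) * mv n G x i" by (rule mv_scale)
    then show "mv n G (\<lambda>j. (1 / x n) * x j) i = e i" using e[OF \<open>i < n\<close>] xn by simp
  qed
qed

text \<open>\<open>M'\<close> is the resolvent \<open>(M\<inverse> - \<delta>)\<inverse>\<close>, written without inverses.\<close>

lemma psd_resolvent:
  assumes M: "psd n M" and \<delta>: "0 \<le> \<delta>" "\<delta> * tr n M < 1"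
  obtains M' where "psd n M'"
    "\<And>i j. i < n \<Longrightarrow> j < n \<Longrightarrow> M' i j = M i j + \<delta> * (\<Sum>k<n. M' i k * M k j)"
proof -
  have s: "sym_mat n M" using M by (simp add: psd_def)
  define G where "G i j = (if i = j then 1 else 0) - \<delta> * M i j" for i j :: nat
  have G: "mv n G x i = x i - \<delta> * mv n M x i" if "i < n" for x i
  proof -
    have "mv n G x i = (\<Sum>j<n. (if i = j then x j else 0) - \<delta> * (M i j * x j))"
      unfolding mv_def by (rule sum.cong) (auto simp: G_def algebra_simps)
    also have "\<dots> = x i - \<delta> * mv n M x i"
      using that by (simp add: sum_subtractf sum_distrib_left mv_def)
    finally show ?thesis .
  qed
  have sG: "sym_mat n G" using s by (auto simp: sym_mat_def G_def)
  have inj: "x i = 0" if z: "\<And>i. i < n \<Longrightarrow> mv n G x i = 0" and "i < n" for x i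
  proof -
    have "ip n x x = ip n x (\<lambda>i. \<delta> * mv n M x i)"
      using z G by (intro ip_cong) auto
    also have "\<dots> \<le> \<delta> * (tr n M * ip n x x)"
      unfolding ip_scale_right by (rule mult_left_mono[OF psd_form_le_tr[OF M] \<delta>(1)])
    finally have "ip n x x * (1 - \<delta> * tr n M) \<le> 0" by (simp add: algebra_simps)
    then have "ip n x x = 0"
      using \<delta>(2) ip_self_nonneg[of n x] by (simp add: mult_le_0_iff)
    then show ?thesis using \<open>i < n\<close> by (simp add: ip_self_eq_0)
  qed
  have surj: "\<exists>x. \<forall>i<n. mv n G x i = e i" for e
    by (rule injective_imp_surjective) (rule inj)
  then have "\<forall>k. \<exists>x. \<forall>i<n. mv n G x i = M i k" by simp
  then obtain X where X: "\<And>k i. i < n \<Longrightarrow> mv n G (X k) i = M i k"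
    using choice[of "\<lambda>k x. \<forall>i<n. mv n G x i = M i k"] by blast
  define M' where "M' i k = X k i" for i k
  have X': "X k i = M i k + \<delta> * mv n M (X k) i" if "i < n" for i k
    using X[OF that, of k] G[OF that, of "X k"] by simp
  \<comment> \<open>Both entries are values of the symmetric form \<open>G\<close> at
    \<open>X j\<close> and \<open>X k\<close>; this makes \<open>M'\<close> symmetric.\<close>
  have sX: "mv n M (X j) k = mv n M (X k) j" if "j < n" "k < n" for j k
  proof -
    have mX: "ip n (X j) (\<lambda>i. M i k) = mv n M (X j) k" if "j < n" "k < n" for j k
      using s that by (auto simp: ip_def mv_def sym_mat_def intro!: sum.cong)
    have "mv n M (X j) k = ip n (X j) (mv n G (X k))"
      unfolding mX[OF that, symmetric] by (rule ip_cong) (auto simp: X)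
    also have "\<dots> = ip n (mv n G (X j)) (X k)" by (rule sym_mat_ip[OF sG])
    also have "\<dots> = ip n (X k) (\<lambda>i. M i j)"
      unfolding ip_commute[of n "X k"] by (rule ip_cong) (auto simp: X)
    finally show ?thesis using mX that by simp
  qed
  have sM': "sym_mat n M'"
    unfolding sym_mat_def M'_def
  proof (intro allI impI)
    fix i j assume "i < n" "j < n"
    then show "X j i = X i j" using X'[of i j] X'[of j i] sX[of i j] s by (simp add: sym_mat_def)
  qed
  have eq: "M' i j = M i j + \<delta> * (\<Sum>k<n. M' i k * M k j)" if "i < n" "j < n" for i j
  proof -
    have "M' i j = M' j i" using sM' that by (simp add: sym_mat_def)
    also have "\<dots> = M j i + \<delta> * mv n M (X i) j" using X'[of j i] that by (simp add: M'_def)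
    also have "M j i = M i j" using s that by (simp add: sym_mat_def)
    also have "mv n M (X i) j = (\<Sum>k<n. M' i k * M k j)"
      unfolding mv_def
    proof (rule sum.cong)
      fix k assume "k \<in> {..<n}"
      then have "M j k = M k j" "X i k = M' i k"
        using s sM' that by (auto simp: sym_mat_def M'_def)
      then show "M j k * X i k = M' i k * M k j" by simp
    qed simp
    finally show ?thesis .
  qed
  have GM': "mv n G (mv n M' x) i = mv n M x i" if "i < n" for x i
  proof -
    have "mv n G (mv n M' x) i = (\<Sum>j<n. \<Sum>k<n. G i j * M' j k * x k)"
      by (simp add: mv_def sum_distrib_left algebra_simps)
    also have "\<dots> = (\<Sum>k<n. \<Sum>j<n. G i j * M' j k * x k)" by (rule sum.swap)
    also have "\<dots> = (\<Sum>k<n. mv n G (X k) i * x k)"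
      by (simp add: mv_def M'_def sum_distrib_right)
    also have "\<dots> = mv n M x i" using X[OF that] by (simp add: mv_def)
    finally show ?thesis .
  qed
  \<comment> \<open>Writing \<open>x = G y\<close> turns the form into the inner product of
    \<open>M y\<close> with \<open>y - \<delta> M y\<close>, which is nonnegative because
    \<open>M^2\<close> is at most \<open>tr n M\<close> times \<open>M\<close> and
    \<open>\<delta> * tr n M < 1\<close>.\<close>
  have "0 \<le> ip n x (mv n M' x)" for x
  proof -
    obtain y where y: "\<forall>i<n. mv n G y i = x i" using surj by blast
    have "ip n x (mv n M' x) = ip n (mv n G y) (mv n M' x)" by (rule ip_cong) (use y in auto)
    also have "\<dots> = ip n y (mv n G (mv n M' x))" using sym_mat_ip[OF sG] by simp
    also have "\<dots> = ip n y (mv n M x)" by (rule ip_cong) (auto simp: GM')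
    also have "\<dots> = ip n (mv n M y) x" by (rule sym_mat_ip[OF s])
    also have "\<dots> = ip n (mv n M y) (\<lambda>i. y i - \<delta> * mv n M y i)"
      by (rule ip_cong) (use y G in auto)
    also have "\<dots> = ip n y (mv n M y) - \<delta> * ip n (mv n M y) (mv n M y)"
      by (simp add: ip_linear ip_commute)
    also have "\<dots> \<ge> 0"
    proof -
      have "\<delta> * ip n (mv n M y) (mv n M y) \<le> \<delta> * (tr n M * ip n y (mv n M y))"
        by (rule mult_left_mono[OF psd_square_le[OF M] \<delta>(1)])
      also have "\<dots> = (\<delta> * tr n M) * ip n y (mv n M y)" by simp
      also have "\<dots> \<le> 1 * ip n y (mv n M y)"
        using \<delta>(2) M by (intro mult_right_mono) (auto simp: psd_def)
      finally show ?thesis by simp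
    qed
    finally show ?thesis .
  qed
  then have "psd n M'" using sM' by (simp add: psd_def)
  then show ?thesis using eq that by blast
qed

lemma resolvent_mv:
  assumes "\<And>i j. i < n \<Longrightarrow> j < n \<Longrightarrow> M' i j = M i j + \<delta> * (\<Sum>k<n. M' i k * M k j)" "i < n"
  shows "mv n M' v i = mv n M v i + \<delta> * mv n M' (mv n M v) i"
proof -
  have "mv n M' v i = (\<Sum>j<n. M i j * v j + \<delta> * (\<Sum>k<n. M' i k * M k j * v j))"
    unfolding mv_def using assms(1)[OF assms(2)]
    by (intro sum.cong) (auto simp: algebra_simps sum_distrib_left)
  also have "\<dots> = mv n M v i + \<delta> * (\<Sum>j<n. \<Sum>k<n. M' i k * M k j * v j)"
    by (simp add: sum.distrib sum_distrib_left mv_def)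
  also have "(\<Sum>j<n. \<Sum>k<n. M' i k * M k j * v j) = (\<Sum>k<n. \<Sum>j<n. M' i k * M k j * v j)"
    by (rule sum.swap)
  also have "\<dots> = mv n M' (mv n M v) i"
    by (simp add: mv_def sum_distrib_left algebra_simps)
  finally show ?thesis .
qed

text \<open>The defining equation, read along the diagonal, gives the exact growth of the barrier
  potential when the barrier is raised by \<open>\<delta>\<close>.\<close>

lemma resolvent_tr:
  assumes M: "psd n M" "psd n M'"
    and "\<And>i j. i < n \<Longrightarrow> j < n \<Longrightarrow> M' i j = M i j + \<delta> * (\<Sum>k<n. M' i k * M k j)"
  shows "tr n M' = tr n M + \<delta> * frob n M M'"
proof -
  have "tr n M' = (\<Sum>i<n. M i i + \<delta> * (\<Sum>k<n. M i k * M' i k))"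
    unfolding tr_def
  proof (rule sum.cong)
    fix i assume i: "i \<in> {..<n}"
    have "(\<Sum>k<n. M' i k * M k i) = (\<Sum>k<n. M i k * M' i k)"
      using M i by (intro sum.cong) (auto simp: psd_def sym_mat_def)
    then show "M' i i = M i i + \<delta> * (\<Sum>k<n. M i k * M' i k)"
      using assms(3)[of i i] i by simp
  qed simp
  then show ?thesis by (simp add: tr_def frob_def sum.distrib sum_distrib_left)
qed

text \<open>The difference \<open>M' - M\<close> is \<open>\<delta> M' M\<close>, and its pairing
  with \<open>M'\<close> is \<open>\<delta>\<close> times the sum of the form \<open>M\<close> over
  the rows of \<open>M'\<close>.\<close>

lemma resolvent_frob_le:
  assumes "psd n M" "0 \<le> \<delta>"
    and eq: "\<And>i j. i < n \<Longrightarrow> j < n \<Longrightarrow> M' i j = M i j + \<delta> * (\<Sum>k<n. M' i k * M k j)"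
  shows "frob n M M' \<le> frob n M' M'"
proof -
  have "frob n M' M' - frob n M M' = (\<Sum>i<n. \<Sum>j<n. (M' i j - M i j) * M' i j)"
    by (simp add: frob_def sum_subtractf algebra_simps)
  also have "\<dots> = (\<Sum>i<n. \<Sum>j<n. (\<delta> * (\<Sum>k<n. M' i k * M k j)) * M' i j)"
  proof (intro sum.cong refl)
    fix i j assume "i \<in> {..<n}" "j \<in> {..<n}"
    then have "M' i j - M i j = \<delta> * (\<Sum>k<n. M' i k * M k j)" using eq[of i j] by simp
    then show "(M' i j - M i j) * M' i j = (\<delta> * (\<Sum>k<n. M' i k * M k j)) * M' i j" by simp
  qed
  also have "\<dots> = (\<Sum>i<n. \<delta> * ip n (M' i) (mv n M (M' i)))"
  proof (rule sum.cong)
    fix i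
    have "(\<Sum>j<n. (\<delta> * (\<Sum>k<n. M' i k * M k j)) * M' i j)
        = (\<Sum>j<n. \<Sum>k<n. \<delta> * M' i k * M k j * M' i j)"
      by (simp add: sum_distrib_left sum_distrib_right algebra_simps)
    also have "\<dots> = (\<Sum>k<n. \<Sum>j<n. \<delta> * M' i k * M k j * M' i j)" by (rule sum.swap)
    also have "\<dots> = \<delta> * ip n (M' i) (mv n M (M' i))"
      by (simp add: ip_def mv_def sum_distrib_left algebra_simps)
    finally show "(\<Sum>j<n. (\<delta> * (\<Sum>k<n. M' i k * M k j)) * M' i j) = \<delta> * ip n (M' i) (mv n M (M' i))" .
  qed simp
  also have "\<dots> \<ge> 0" using assms by (intro sum_nonneg) (auto simp: psd_def)
  finally show ?thesis by simp
qed

text \<open>The Sherman--Morrison formula for \<open>(M\<inverse> + t u u\<^sup>T)\<inverse>\<close>.\<close>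

definition rank1_update :: "nat \<Rightarrow> (nat \<Rightarrow> nat \<Rightarrow> real) \<Rightarrow> real \<Rightarrow> (nat \<Rightarrow> real) \<Rightarrow> nat \<Rightarrow> nat \<Rightarrow> real"
  where "rank1_update n M t u =
    (\<lambda>i j. M i j - t / (1 + t * ip n u (mv n M u)) * mv n M u i * mv n M u j)"

lemma mv_minus_rank1:
  "mv n (\<lambda>i j. M i j - c * v i * v j) x i = mv n M x i - c * ip n v x * v i"
  by (simp add: mv_def ip_def sum_subtractf sum_distrib_left sum_distrib_right algebra_simps)

lemma tr_minus_rank1: "tr n (\<lambda>i j. M i j - c * v i * v j) = tr n M - c * ip n v v"
  by (simp add: tr_def ip_def sum_subtractf sum_distrib_left algebra_simps)

lemma mv_rank1_update:
  "mv n (rank1_update n M t u) x i =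
    mv n M x i - t / (1 + t * ip n u (mv n M u)) * ip n (mv n M u) x * mv n M u i"
  unfolding rank1_update_def by (rule mv_minus_rank1)

text \<open>By Cauchy-Schwarz for the form \<open>M\<close> at \<open>x\<close> and
  \<open>u\<close>, the subtracted term is at most the form itself.\<close>

lemma psd_rank1_update:
  assumes M: "psd n M" and "0 \<le> t"
  shows "psd n (rank1_update n M t u)"
proof -
  define b where "b = ip n u (mv n M u)"
  have b: "0 \<le> b" using M by (simp add: psd_def b_def)
  have "0 \<le> ip n x (mv n (rank1_update n M t u) x)" for x
  proof -
    define q where "q = ip n x (mv n M x)"
    define r where "r = ip n x (mv n M u)"
    have q: "0 \<le> q" using M by (simp add: psd_def q_def)
    have r: "r\<^sup>2 \<le> q * b" unfolding r_def q_def b_def by (rule psd_Cauchy_Schwarz[OF M])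
    define c where "c = t / (1 + t * b)"
    have "ip n x (mv n (rank1_update n M t u) x) = q - c * r * r"
      unfolding mv_rank1_update b_def[symmetric] c_def[symmetric] ip_diff_right ip_scale_right
      by (simp add: q_def r_def ip_commute)
    moreover have "c * r * r \<le> q"
    proof -
      have "t * r\<^sup>2 \<le> t * (q * b)" by (rule mult_left_mono[OF r assms(2)])
      also have "\<dots> \<le> q * (1 + t * b)" using q by (simp add: algebra_simps)
      finally have "t * r\<^sup>2 \<le> q * (1 + t * b)" .
      moreover have "0 < 1 + t * b" using b assms(2) by (simp add: add_pos_nonneg)
      ultimately show ?thesis by (simp add: c_def field_simps power2_eq_square)
    qed
    ultimately show ?thesis by simp
  qed
  moreover have "sym_mat n (rank1_update n M t u)"
    using M by (auto simp: psd_def sym_mat_def rank1_update_def)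
  ultimately show ?thesis by (simp add: psd_def)
qed

lemma tr_rank1_update:
  "tr n (rank1_update n M t u) =
    tr n M - t / (1 + t * ip n u (mv n M u)) * ip n (mv n M u) (mv n M u)"
  unfolding rank1_update_def by (rule tr_minus_rank1)

text \<open>The operator inverted by \<open>M\<close> never appears as a matrix; it enters through
  pairs \<open>y\<close>, \<open>x\<close> with \<open>M y = x\<close>. Adding
  \<open>t u u^T\<close> to it adds \<open>t * ip n u x * u\<close> to \<open>y\<close>.\<close>

lemma rank1_update_left_inverse:
  assumes M: "psd n M" and "0 \<le> t"
    and inv: "\<And>i. i < n \<Longrightarrow> mv n M y i = x i" and "i < n"
  shows "mv n (rank1_update n M t u) (\<lambda>i. y i + t * ip n u x * u i) i = x i"
proof -
  define b where "b = ip n u (mv n M u)"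
  define d where "d = 1 + t * b"
  define v where "v = mv n M u"
  have "0 \<le> b" using M by (simp add: psd_def b_def)
  then have d: "0 < d" using assms(2) by (simp add: d_def add_pos_nonneg)
  have s: "sym_mat n M" using M by (simp add: psd_def)
  have "ip n v y = ip n u (mv n M y)" using sym_mat_ip[OF s] by (simp add: v_def)
  also have "\<dots> = ip n u x" by (rule ip_cong) (use inv in auto)
  finally have vy: "ip n v y = ip n u x" .
  have "ip n v (\<lambda>i. y i + t * ip n u x * u i) = ip n u x * d"
    unfolding ip_add_right ip_scale_right vy d_def b_def
    by (simp add: v_def ip_commute algebra_simps)
  then have "mv n (rank1_update n M t u) (\<lambda>i. y i + t * ip n u x * u i) i
      = x i + t * ip n u x * v i - t / d * (ip n u x * d) * v i"
    unfolding mv_rank1_update using inv[OF assms(4)]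
    by (simp add: mv_add mv_scale d_def b_def v_def)
  then show ?thesis using d by simp
qed

section \<open>Sparsification of an isotropic system\<close>

lemma sum_fun_upd_add:
  fixes f :: "'b \<Rightarrow> real"
  assumes "finite J" "p \<in> J"
  shows "(\<Sum>l\<in>J. (c(p := c p + t)) l * f l) = (\<Sum>l\<in>J. c l * f l) + t * f p"
proof -
  have "(\<Sum>l\<in>J. (c(p := c p + t)) l * f l) = (\<Sum>l\<in>J. c l * f l + (if l = p then t * f p else 0))"
    by (rule sum.cong) (auto simp: algebra_simps)
  also have "\<dots> = (\<Sum>l\<in>J. c l * f l) + t * f p"
    using assms by (simp add: sum.distrib)
  finally show ?thesis .
qed

lemma exists_le_of_weighted_sum_le:
  fixes F :: "'b \<Rightarrow> real"
  assumes "finite J" "\<And>j. j \<in> J \<Longrightarrow> 0 \<le> q j" "0 < sum q J"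
    and "(\<Sum>j\<in>J. q j * F j) \<le> sum q J * v"
  shows "\<exists>j\<in>J. F j \<le> v"
proof (rule ccontr)
  assume "\<not> ?thesis"
  then have F: "\<And>j. j \<in> J \<Longrightarrow> v < F j" by force
  obtain p where p: "p \<in> J" "0 < q p"
    using assms(2,3) by (metis less_eq_real_def less_le_not_le sum_nonpos)
  have "sum q J * v = (\<Sum>j\<in>J. q j * v)" by (simp add: sum_distrib_right)
  also have "\<dots> < (\<Sum>j\<in>J. q j * F j)"
    using F assms(1,2) p by (intro sum_strict_mono_ex1) (force intro: mult_left_mono less_imp_le)+
  finally show False using assms(4) by simp
qed

text \<open>John's decomposition of the identity in a relaxed form: the vectors may be shorter than
  one, and the mass is \<open>2 n\<close> instead of \<open>n\<close>.\<close>

locale john_weights =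
  fixes n :: nat and J :: "'b set" and w :: "'b \<Rightarrow> real" and u :: "'b \<Rightarrow> nat \<Rightarrow> real"
  assumes n_pos: "0 < n" and fin: "finite J"
    and w_nonneg: "\<And>j. j \<in> J \<Longrightarrow> 0 \<le> w j"
    and u_le: "\<And>j. j \<in> J \<Longrightarrow> ip n (u j) (u j) \<le> 1"
    and isotropic: "\<And>i k. i < n \<Longrightarrow> k < n \<Longrightarrow> (\<Sum>j\<in>J. w j * (u j i * u j k)) = (if i = k then 1 else 0)"
    and centered: "\<And>i. i < n \<Longrightarrow> (\<Sum>j\<in>J. w j * u j i) = 0"
    and total: "sum w J = 2 * real n"
begin

text \<open>\<open>gram c \<theta>\<close> is the operator \<open>A - \<theta> I\<close> with \<open>A = \<Sum>c\<^sub>l u\<^sub>l u\<^sub>l\<^sup>T\<close>; \<open>\<theta>\<close> is the lower barrier for \<open>A\<close>.\<close>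

definition gram :: "('b \<Rightarrow> real) \<Rightarrow> real \<Rightarrow> (nat \<Rightarrow> real) \<Rightarrow> nat \<Rightarrow> real"
  where "gram c \<theta> x = (\<lambda>i. (\<Sum>l\<in>J. c l * ip n (u l) x * u l i) - \<theta> * x i)"

definition moment :: "('b \<Rightarrow> real) \<Rightarrow> nat \<Rightarrow> real"
  where "moment c = (\<lambda>i. \<Sum>l\<in>J. c l * u l i)"

lemma sum_w_ip: "(\<Sum>l\<in>J. w l * ip n a (u l)) = 0"
proof -
  have "(\<Sum>l\<in>J. w l * ip n a (u l)) = ip n a (moment w)"
    unfolding moment_def by (rule ip_sum_right[symmetric])
  also have "\<dots> = 0" unfolding ip_def by (rule sum.neutral) (simp add: moment_def centered)
  finally show ?thesis .
qed

lemma sum_w_ip_ip: "(\<Sum>l\<in>J. w l * (ip n a (u l) * ip n c (u l))) = ip n a c"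
proof -
  have "(\<Sum>l\<in>J. w l * (ip n a (u l) * ip n c (u l)))
      = (\<Sum>l\<in>J. \<Sum>i<n. \<Sum>k<n. a i * c k * (w l * (u l i * u l k)))"
    unfolding ip_def sum_product
    unfolding sum_distrib_left by (intro sum.cong refl) (simp only: ac_simps)
  also have "\<dots> = (\<Sum>i<n. \<Sum>l\<in>J. \<Sum>k<n. a i * c k * (w l * (u l i * u l k)))"
    by (rule sum.swap)
  also have "\<dots> = (\<Sum>i<n. \<Sum>k<n. \<Sum>l\<in>J. a i * c k * (w l * (u l i * u l k)))"
    by (intro sum.cong refl sum.swap)
  also have "\<dots> = (\<Sum>i<n. \<Sum>k<n. if i = k then a i * c k else 0)"
    unfolding sum_distrib_left[symmetric] by (intro sum.cong refl) (simp add: isotropic)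
  also have "\<dots> = ip n a c" by (simp add: ip_def)
  finally show ?thesis .
qed

lemma sum_w_form: "(\<Sum>l\<in>J. w l * ip n (u l) (mv n M (u l))) = tr n M"
proof -
  have "ip n v (mv n M v) = (\<Sum>i<n. ip n (unit_vec i) v * ip n (M i) v)" for v
    by (simp add: ip_unit_vec) (simp add: ip_def mv_def)
  then have "(\<Sum>l\<in>J. w l * ip n (u l) (mv n M (u l)))
      = (\<Sum>l\<in>J. \<Sum>i<n. w l * (ip n (unit_vec i) (u l) * ip n (M i) (u l)))"
    by (simp add: sum_distrib_left)
  also have "\<dots> = (\<Sum>i<n. \<Sum>l\<in>J. w l * (ip n (unit_vec i) (u l) * ip n (M i) (u l)))"
    by (rule sum.swap)
  also have "\<dots> = tr n M" unfolding sum_w_ip_ip by (simp add: ip_unit_vec tr_def)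
  finally show ?thesis .
qed

lemma sum_w_mv_norm: "(\<Sum>l\<in>J. w l * ip n (mv n M (u l)) (mv n M (u l))) = frob n M M"
proof -
  have "ip n (mv n M v) (mv n M v) = (\<Sum>i<n. ip n (M i) v * ip n (M i) v)" for v
    by (simp add: ip_def mv_def)
  then have "(\<Sum>l\<in>J. w l * ip n (mv n M (u l)) (mv n M (u l)))
      = (\<Sum>l\<in>J. \<Sum>i<n. w l * (ip n (M i) (u l) * ip n (M i) (u l)))"
    by (simp add: sum_distrib_left)
  also have "\<dots> = (\<Sum>i<n. \<Sum>l\<in>J. w l * (ip n (M i) (u l) * ip n (M i) (u l)))"
    by (rule sum.swap)
  also have "\<dots> = frob n M M" unfolding sum_w_ip_ip by (simp add: frob_def ip_def)
  finally show ?thesis .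
qed

lemma gram_upd:
  "p \<in> J \<Longrightarrow> gram (c(p := c p + t)) \<theta> x = (\<lambda>i. gram c \<theta> x i + t * ip n (u p) x * u p i)"
  using sum_fun_upd_add[OF fin, of p c t "\<lambda>l. ip n (u l) x * u l i" for i]
  by (simp add: gram_def mult.assoc algebra_simps fun_eq_iff del: fun_upd_apply)

lemma moment_upd: "p \<in> J \<Longrightarrow> moment (c(p := c p + t)) = (\<lambda>i. moment c i + t * u p i)"
  using sum_fun_upd_add[OF fin, of p c t "\<lambda>l. u l i" for i]
  by (simp add: moment_def fun_eq_iff del: fun_upd_apply)

text \<open>
  Here \<open>M = (A - \<theta>)\<inverse>\<close> and \<open>N = (A - \<theta> - \<delta>)\<inverse>\<close>. With \<open>b\<^sub>j = u\<^sub>j\<^sup>T N u\<^sub>j\<close>, index \<open>j\<close> is drawn with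
  probability proportional to \<open>w\<^sub>j (1 + b\<^sub>j)\<close> and added with weight \<open>1 / (1 + b\<^sub>j)\<close>, so that each
  update is damped by a bounded factor while its mean is still governed by the weights \<open>w\<^sub>j\<close>.
\<close>

lemma barrier_step:
  assumes M: "psd n M" and tr: "tr n M \<le> real n" and \<kappa>: "0 \<le> \<kappa>"
    and inv: "\<And>x i. i < n \<Longrightarrow> mv n M (gram c \<theta> x) i = x i"
  obtains p t M' where "p \<in> J" "0 \<le> t" "t \<le> 1" "psd n M'"
    "\<And>x i. i < n \<Longrightarrow> mv n M' (gram (c(p := c p + t)) (\<theta> + 1 / (8 * real n)) x) i = x i"
    "tr n M' + \<kappa> * ip n (moment (c(p := c p + t))) (moment (c(p := c p + t)))
      \<le> tr n M + \<kappa> * ip n (moment c) (moment c) + \<kappa>"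
proof -
  \<comment> \<open>Small enough for the resolvent to exist when the trace of \<open>M\<close> is at
    most \<open>n\<close>; the factor 8 gives \<open>4 n \<delta> = 1 / 2\<close>, which balances
    the final estimate.\<close>
  define \<delta> where "\<delta> = 1 / (8 * real n)"
  have \<delta>: "0 \<le> \<delta>" by (simp add: \<delta>_def)
  have \<delta>tr: "\<delta> * tr n M \<le> 1 / 8"
    using mult_left_mono[OF tr \<delta>] n_pos by (simp add: \<delta>_def)
  obtain N where N: "psd n N"
    and eq: "\<And>i j. i < n \<Longrightarrow> j < n \<Longrightarrow> N i j = M i j + \<delta> * (\<Sum>k<n. N i k * M k j)"
    by (rule psd_resolvent[OF M \<delta>]) (use \<delta>tr in auto)
  have trN: "tr n N = tr n M + \<delta> * frob n M N" by (rule resolvent_tr[OF M N eq])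
  have frob: "frob n M N \<le> frob n N N" by (rule resolvent_frob_le[OF M \<delta> eq])
  \<comment> \<open>The trace of \<open>N\<close> recurs on the right with coefficient at most
    \<open>1 / 8\<close> and is absorbed.\<close>
  have "tr n N \<le> tr n M + \<delta> * (tr n M * tr n N)"
    using mult_left_mono[OF psd_frob_le[OF M N] \<delta>] trN by simp
  moreover have "(\<delta> * tr n M) * tr n N \<le> 1 / 8 * tr n N"
    by (rule mult_right_mono[OF \<delta>tr psd_tr[OF N]])
  ultimately have trN2: "tr n N \<le> 2 * real n" using tr by (simp add: mult.assoc)
  have invN: "mv n N (gram c (\<theta> + \<delta>) x) i = x i" if "i < n" for x i
  proof -
    have "gram c (\<theta> + \<delta>) x = (\<lambda>i. gram c \<theta> x i - \<delta> * x i)"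
      by (simp add: gram_def algebra_simps fun_eq_iff)
    then have "mv n N (gram c (\<theta> + \<delta>) x) i = mv n N (gram c \<theta> x) i - \<delta> * mv n N x i"
      by (simp add: mv_diff mv_scale)
    also have "mv n N (gram c \<theta> x) i = mv n M (gram c \<theta> x) i + \<delta> * mv n N (mv n M (gram c \<theta> x)) i"
      by (rule resolvent_mv[OF eq that])
    also have "mv n N (mv n M (gram c \<theta> x)) = mv n N x" using inv by (intro mv_cong) auto
    finally show ?thesis using inv that by simp
  qed
  define b where "b j = ip n (u j) (mv n N (u j))" for j
  define a where "a j = ip n (mv n N (u j)) (mv n N (u j))" for j
  define t where "t j = 1 / (1 + b j)" for j
  define y where "y = moment c"
  \<comment> \<open>The combined potential after \<open>u j\<close> has been added with weight
    \<open>t j\<close>.\<close>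
  define F where "F j = tr n (rank1_update n N (t j) (u j))
    + \<kappa> * ip n (\<lambda>i. y i + t j * u j i) (\<lambda>i. y i + t j * u j i)" for j
  have b: "0 \<le> b j" for j using N by (simp add: b_def psd_def)
  have a: "0 \<le> a j" for j by (simp add: a_def)
  have t: "0 \<le> t j" "t j \<le> 1" "(1 + b j) * t j = 1" for j
    using b[of j] by (auto simp: t_def)
  define q where "q j = w j * (1 + b j)" for j
  have q: "0 \<le> q j" if "j \<in> J" for j using w_nonneg[OF that] b[of j] by (simp add: q_def)
  have sq: "sum q J = 2 * real n + tr n N"
    using sum_w_form[of N] by (simp add: q_def b_def algebra_simps sum.distrib total)
  have F: "q j * F j \<le> q j * tr n N - w j * a j / 2
    + \<kappa> * (q j * ip n y y + 2 * (w j * ip n y (u j)) + w j)" if j: "j \<in> J" for j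
  proof -
    \<comment> \<open>Since \<open>t j * b j \<le> 1\<close>, the Sherman-Morrison denominator is at
      most 2.\<close>
    have "t j / (1 + t j * b j) * a j \<ge> t j / 2 * a j"
    proof (rule mult_right_mono[OF _ a])
      have "t j * b j \<le> 1" using b[of j] by (simp add: t_def field_simps)
      then show "t j / 2 \<le> t j / (1 + t j * b j)"
        using t b by (intro divide_left_mono) (auto intro!: mult_pos_pos add_pos_nonneg)
    qed
    then have "tr n (rank1_update n N (t j) (u j)) \<le> tr n N - t j / 2 * a j"
      unfolding tr_rank1_update a_def b_def by linarith
    moreover have "ip n (\<lambda>i. y i + t j * u j i) (\<lambda>i. y i + t j * u j i)
        = ip n y y + 2 * t j * ip n y (u j) + t j * t j * ip n (u j) (u j)"
      by (simp add: ip_linear ip_commute algebra_simps)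
    moreover have "t j * t j * ip n (u j) (u j) \<le> t j * 1 * 1"
      using t u_le[OF j] by (intro mult_mono) auto
    ultimately have "F j \<le> tr n N - t j / 2 * a j
        + \<kappa> * (ip n y y + 2 * t j * ip n y (u j) + t j)"
      unfolding F_def using \<kappa> by (intro add_mono mult_left_mono) auto
    then have "q j * F j \<le> q j * (tr n N - t j / 2 * a j
        + \<kappa> * (ip n y y + 2 * t j * ip n y (u j) + t j))"
      by (rule mult_left_mono[OF _ q[OF j]])
    also have "\<dots> = q j * tr n N - (q j * t j) * a j / 2
        + \<kappa> * (q j * ip n y y + 2 * ((q j * t j) * ip n y (u j)) + q j * t j)"
      by (simp add: algebra_simps)
    also have "q j * t j = w j" using t(3)[of j] by (simp add: q_def mult.assoc)
    finally show ?thesis .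
  qed
  have "(\<Sum>j\<in>J. q j * F j) \<le> (\<Sum>j\<in>J. q j * tr n N - w j * a j / 2
      + \<kappa> * (q j * ip n y y + 2 * (w j * ip n y (u j)) + w j))"
    by (rule sum_mono) (rule F)
  also have "\<dots> = sum q J * tr n N - (\<Sum>j\<in>J. w j * a j) / 2
      + \<kappa> * (sum q J * ip n y y + 2 * (\<Sum>j\<in>J. w j * ip n y (u j)) + sum w J)"
    by (simp add: sum.distrib sum_subtractf sum_distrib_left sum_distrib_right sum_divide_distrib
        distrib_left)
  \<comment> \<open>The terms linear in \<open>y\<close> cancel because the weights \<open>w\<close>
    are centered.\<close>
  also have "\<dots> = sum q J * tr n N - frob n N N / 2 + \<kappa> * (sum q J * ip n y y + 2 * real n)"
    by (simp add: sum_w_ip sum_w_mv_norm a_def total)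
  \<comment> \<open>As \<open>sum q J \<le> 4 n\<close>, raising the barrier costs at most
    \<open>frob n N N / 2\<close>, which the rank-one updates win back. The moment term grows by
    \<open>\<kappa> * 2 n\<close>, at most \<open>\<kappa> * sum q J\<close>.\<close>
  also have "\<dots> \<le> sum q J * (tr n M + \<kappa> * ip n y y + \<kappa>)"
  proof -
    have "frob n N N \<ge> 0" unfolding frob_def by (intro sum_nonneg) auto
    then have "sum q J * (\<delta> * frob n N N) \<le> 4 * real n * (\<delta> * frob n N N)"
      using sq trN2 \<delta> by (intro mult_right_mono) auto
    moreover have "sum q J * (\<delta> * frob n M N) \<le> sum q J * (\<delta> * frob n N N)"
      using frob sq \<delta> psd_tr[OF N] by (intro mult_left_mono) auto
    moreover have "4 * real n * (\<delta> * frob n N N) = frob n N N / 2"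
      using n_pos by (simp add: \<delta>_def)
    moreover have "\<kappa> * (2 * real n) \<le> \<kappa> * sum q J"
      using \<kappa> psd_tr[OF N] sq by (intro mult_left_mono) auto
    moreover have "sum q J * tr n N = sum q J * tr n M + sum q J * (\<delta> * frob n M N)"
      by (simp add: trN distrib_left)
    moreover have "\<kappa> * (sum q J * ip n y y) = sum q J * (\<kappa> * ip n y y)" "\<kappa> * sum q J = sum q J * \<kappa>"
      by simp_all
    ultimately show ?thesis by (simp only: distrib_left)
  qed
  finally have le: "(\<Sum>j\<in>J. q j * F j) \<le> sum q J * (tr n M + \<kappa> * ip n y y + \<kappa>)" .
  have "0 < sum q J" using sq n_pos psd_tr[OF N] by simp
  then obtain p where p: "p \<in> J" "F p \<le> tr n M + \<kappa> * ip n y y + \<kappa>"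
    using exists_le_of_weighted_sum_le[of J q, OF fin q _ le] by blast
  show ?thesis
  proof (rule that[OF p(1) t(1)[of p] t(2)[of p] psd_rank1_update[OF N t(1)[of p], of "u p"]])
    fix x i assume "i < n"
    show "mv n (rank1_update n N (t p) (u p)) (gram (c(p := c p + t p)) (\<theta> + 1 / (8 * real n)) x) i = x i"
      unfolding gram_upd[OF p(1)] \<delta>_def[symmetric]
      by (rule rank1_update_left_inverse[OF N t(1) invN \<open>i < n\<close>])
  next
    show "tr n (rank1_update n N (t p) (u p))
        + \<kappa> * ip n (moment (c(p := c p + t p))) (moment (c(p := c p + t p)))
      \<le> tr n M + \<kappa> * ip n (moment c) (moment c) + \<kappa>"
      unfolding moment_upd[OF p(1)] using p(2) by (simp add: F_def y_def)
  qed
qed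

text \<open>The barrier starts at -2 and rises by \<open>1 / (8 n)\<close> per step. With the factor
  \<open>n / (2 s)\<close> on the moment, \<open>s\<close> steps add at most \<open>n / 2\<close> to
  the initial potential \<open>n / 2\<close>, so the trace stays at most \<open>n\<close>, as each
  step requires.\<close>

lemma barrier_iteration:
  assumes "0 < s" "k \<le> s"
  shows "\<exists>S c M. S \<subseteq> J \<and> card S \<le> k \<and> (\<forall>j\<in>J. 0 \<le> c j) \<and> (\<forall>j. j \<notin> S \<longrightarrow> c j = 0) \<and>
    sum c J \<le> real k \<and> psd n M \<and>
    (\<forall>x. \<forall>i<n. mv n M (gram c (real k / (8 * real n) - 2) x) i = x i) \<and>
    tr n M + real n / (2 * real s) * ip n (moment c) (moment c)
      \<le> real n / 2 + real n / (2 * real s) * real k"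
  using assms(2)
proof (induction k)
  case 0
  \<comment> \<open>For the zero operator and the barrier -2 the resolvent is half the
    identity.\<close>
  define M :: "nat \<Rightarrow> nat \<Rightarrow> real" where "M i j = (if i = j then 1 / 2 else 0)" for i j
  have mv: "mv n M x i = x i / 2" if "i < n" for x i
    using that by (simp add: mv_def M_def if_distrib[of "\<lambda>c. c * _"] cong: if_cong)
  have "0 \<le> ip n x (mv n M x)" for x
  proof -
    have "ip n x (mv n M x) = ip n x (\<lambda>i. (1 / 2) * x i)" by (rule ip_cong) (auto simp: mv)
    then show ?thesis using ip_self_nonneg[of n x] unfolding ip_scale_right by linarith
  qed
  then have "psd n M" by (simp add: psd_def sym_mat_def M_def)
  moreover have "tr n M = real n / 2" by (simp add: tr_def M_def)
  moreover have "\<forall>x. \<forall>i<n. mv n M (gram (\<lambda>_. 0) (- 2) x) i = x i"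
    by (simp add: mv gram_def)
  ultimately show ?case
    by (intro exI[of _ "{}"] exI[of _ "\<lambda>_. 0"] exI[of _ M]) (auto simp: moment_def ip_def)
next
  case (Suc k)
  define \<kappa> where "\<kappa> = real n / (2 * real s)"
  have \<kappa>: "0 \<le> \<kappa>" by (simp add: \<kappa>_def)
  obtain S c M where IH: "S \<subseteq> J" "card S \<le> k" "\<forall>j\<in>J. 0 \<le> c j" "\<forall>j. j \<notin> S \<longrightarrow> c j = 0"
    "sum c J \<le> real k" "psd n M"
    "\<forall>x. \<forall>i<n. mv n M (gram c (real k / (8 * real n) - 2) x) i = x i"
    "tr n M + \<kappa> * ip n (moment c) (moment c) \<le> real n / 2 + \<kappa> * real k"
    using Suc.IH[OF Suc_leD[OF Suc.prems]] unfolding \<kappa>_def by blast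
  have "\<kappa> * real k \<le> \<kappa> * real s" using \<kappa> Suc.prems by (intro mult_left_mono) auto
  also have "\<kappa> * real s = real n / 2" using assms(1) by (simp add: \<kappa>_def)
  finally have "tr n M \<le> real n"
    using IH(8) mult_nonneg_nonneg[OF \<kappa> ip_self_nonneg[of n "moment c"]] by linarith
  then obtain p t M' where step: "p \<in> J" "0 \<le> t" "t \<le> 1" "psd n M'"
    "\<And>x i. i < n \<Longrightarrow> mv n M' (gram (c(p := c p + t)) (real k / (8 * real n) - 2 + 1 / (8 * real n)) x) i = x i"
    "tr n M' + \<kappa> * ip n (moment (c(p := c p + t))) (moment (c(p := c p + t)))
      \<le> tr n M + \<kappa> * ip n (moment c) (moment c) + \<kappa>"
    using barrier_step[OF IH(6) _ \<kappa>, of c "real k / (8 * real n) - 2"] IH(7) by metis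
  have l: "real k / (8 * real n) - 2 + 1 / (8 * real n) = real (Suc k) / (8 * real n) - 2"
    by (simp add: add_divide_distrib)
  have "sum (c(p := c p + t)) J = sum c J + t"
    using sum_fun_upd_add[OF fin step(1), of c t "\<lambda>_. 1"] by simp
  then have "sum (c(p := c p + t)) J \<le> real (Suc k)" using IH(5) step(3) by simp
  moreover have "card (insert p S) \<le> Suc k"
    using IH(2) finite_subset[OF IH(1) fin] by (simp add: card_insert_if)
  moreover have "insert p S \<subseteq> J" using IH(1) step(1) by simp
  moreover have "\<forall>j\<in>J. 0 \<le> (c(p := c p + t)) j" using IH(3) step(1,2) by simp
  moreover have "\<forall>j. j \<notin> insert p S \<longrightarrow> (c(p := c p + t)) j = 0" using IH(4) by simp
  moreover have "tr n M' + \<kappa> * ip n (moment (c(p := c p + t))) (moment (c(p := c p + t)))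
      \<le> real n / 2 + \<kappa> * real (Suc k)"
    using step(6) IH(8) by (simp add: algebra_simps)
  ultimately show ?case
    using step(4,5) unfolding l \<kappa>_def[symmetric]
    by (intro exI[of _ "insert p S"] exI[of _ "c(p := c p + t)"] exI[of _ M']) blast
qed

text \<open>After \<open>s\<close> steps the barrier stands at \<open>s / (8 n) - 2\<close>, which
  is at least \<open>s / (16 n)\<close> because \<open>s \<ge> 32 n\<close>. The potential is then
  at most \<open>n\<close>, which bounds the moment.\<close>

lemma sparse_weights:
  assumes "32 * n \<le> s"
  obtains S c where "S \<subseteq> J" "card S \<le> s" "\<And>j. j \<in> J \<Longrightarrow> 0 \<le> c j" "\<And>j. j \<notin> S \<Longrightarrow> c j = 0"
    "sum c J \<le> real s" "ip n (moment c) (moment c) \<le> 2 * real s"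
    "\<And>x. real s / (16 * real n) * ip n x x \<le> (\<Sum>l\<in>J. c l * (ip n (u l) x)\<^sup>2)"
proof -
  have s: "0 < s" using assms n_pos by simp
  define \<theta> where "\<theta> = real s / (8 * real n) - 2"
  obtain S c M where *: "S \<subseteq> J" "card S \<le> s" "\<forall>j\<in>J. 0 \<le> c j" "\<forall>j. j \<notin> S \<longrightarrow> c j = 0"
    "sum c J \<le> real s" and M: "psd n M" "\<forall>x. \<forall>i<n. mv n M (gram c \<theta> x) i = x i"
    "tr n M + real n / (2 * real s) * ip n (moment c) (moment c)
      \<le> real n / 2 + real n / (2 * real s) * real s"
    using barrier_iteration[OF s order_refl] unfolding \<theta>_def by blast
  have "real n / (2 * real s) * ip n (moment c) (moment c) \<le> real n"
    using M(3) psd_tr[OF M(1)] s by simp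
  then have mom: "ip n (moment c) (moment c) \<le> 2 * real s"
    using s n_pos by (simp add: field_simps)
  have form: "real s / (16 * real n) * ip n x x \<le> (\<Sum>l\<in>J. c l * (ip n (u l) x)\<^sup>2)" for x
  proof -
    let ?g = "gram c \<theta> x"
    \<comment> \<open>Since \<open>M\<close> maps \<open>?g\<close> back to \<open>x\<close>,
      positivity of \<open>M\<close> at \<open>?g\<close> says that the second moment lies above the
      barrier \<open>\<theta>\<close>.\<close>
    have "0 \<le> ip n ?g (mv n M ?g)" using M(1) by (simp add: psd_def)
    also have "\<dots> = ip n x ?g" unfolding ip_commute[of n ?g] by (rule ip_cong) (use M(2) in auto)
    also have "\<dots> = (\<Sum>l\<in>J. c l * (ip n (u l) x)\<^sup>2) - \<theta> * ip n x x"
      unfolding gram_def ip_diff_right ip_scale_right ip_sum_right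
      by (simp add: power2_eq_square ip_commute algebra_simps)
    finally have "\<theta> * ip n x x \<le> (\<Sum>l\<in>J. c l * (ip n (u l) x)\<^sup>2)" by simp
    moreover have "real s / (16 * real n) \<le> \<theta>"
    proof -
      have "2 \<le> real s / (16 * real n)"
        using assms n_pos by (simp add: field_simps)
      then show ?thesis using n_pos by (simp add: \<theta>_def field_simps)
    qed
    then have "real s / (16 * real n) * ip n x x \<le> \<theta> * ip n x x" by (rule mult_right_mono) simp
    ultimately show ?thesis by linarith
  qed
  show ?thesis by (rule that[OF *(1,2) _ _ *(5) mom form]) (use * in auto)
qed

text \<open>The weights \<open>c\<close> and \<open>f\<close> together have mass at most
  \<open>s + 2 n sqrt (2 s)\<close>. The radius is this mass divided by the lower bound
  \<open>s / (16 n)\<close> on the second moment.\<close>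

lemma sparse_polar_bound:
  assumes "32 * n \<le> s"
  obtains S where "S \<subseteq> J" "S \<noteq> {}" "card S \<le> s + n + 1"
    "\<And>x. (\<And>j. j \<in> S \<Longrightarrow> ip n (u j) x \<le> 1) \<Longrightarrow>
      sqrt (ip n x x) \<le> 16 * real n + 32 * (real n)\<^sup>2 * sqrt (2 * real s) / real s"
proof -
  have s: "0 < s" using assms n_pos by simp
  obtain S c where S: "S \<subseteq> J" "card S \<le> s" and c: "\<And>j. j \<in> J \<Longrightarrow> 0 \<le> c j" "\<And>j. j \<notin> S \<Longrightarrow> c j = 0"
    "sum c J \<le> real s" and mom: "ip n (moment c) (moment c) \<le> 2 * real s"
    and form: "\<And>x. real s / (16 * real n) * ip n x x \<le> (\<Sum>l\<in>J. c l * (ip n (u l) x)\<^sup>2)"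
    using sparse_weights[OF assms] by blast
  define y where "y = moment c"
  \<comment> \<open>These weights are nonnegative by Cauchy-Schwarz; centering gives their mass
    \<open>2 n |y|\<close>, and isotropy and centering give their first moment
    \<open>- y\<close>.\<close>
  define e where "e j = w j * (sqrt (ip n y y) - ip n y (u j))" for j
  have e: "0 \<le> e j" if "j \<in> J" for j
  proof -
    have "ip n y (u j) \<le> sqrt (ip n y y) * sqrt (ip n (u j) (u j))"
      using ip_le_sqrt[of n y "u j"] by linarith
    also have "\<dots> \<le> sqrt (ip n y y) * 1"
      using u_le[OF that] by (intro mult_left_mono) auto
    finally show ?thesis using w_nonneg[OF that] by (simp add: e_def)
  qed
  have se: "sum e J = 2 * real n * sqrt (ip n y y)"
    using sum_w_ip[of y]
    by (simp add: e_def right_diff_distrib sum_subtractf sum_distrib_right[symmetric] total)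
  have eu: "(\<Sum>j\<in>J. e j * u j i) = - y i" if i: "i < n" for i
  proof -
    have "(\<Sum>j\<in>J. e j * u j i) = sqrt (ip n y y) * (\<Sum>j\<in>J. w j * u j i)
        - (\<Sum>j\<in>J. w j * (ip n y (u j) * ip n (unit_vec i) (u j)))"
      using i by (simp add: e_def right_diff_distrib left_diff_distrib sum_subtractf
          sum_distrib_left ip_unit_vec mult_ac)
    also have "\<dots> = - y i"
      unfolding sum_w_ip_ip using i by (simp add: centered ip_commute[of n y "unit_vec i"] ip_unit_vec)
    finally show ?thesis .
  qed
  obtain K f where K: "K \<subseteq> J" "card K \<le> Suc n" "\<forall>j\<in>K. 0 \<le> f j" "sum f K = sum e J"
    "\<forall>i<n. (\<Sum>j\<in>K. f j * u j i) = (\<Sum>j\<in>J. e j * u j i)"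
    using caratheodory_weights[OF fin, of e n u] e by blast
  have bound: "sqrt (ip n x x) \<le> 16 * real n + 32 * (real n)\<^sup>2 * sqrt (2 * real s) / real s"
    if x: "\<And>j. j \<in> S \<union> K \<Longrightarrow> ip n (u j) x \<le> 1" for x
  proof -
    define N where "N = sqrt (ip n x x)"
    have N: "0 \<le> N" "N * N = ip n x x" by (auto simp: N_def)
    define v where "v j = ip n (u j) x" for j
    \<comment> \<open>The expression is \<open>(1 - v j) * (N + v j)\<close>: the first factor is
      nonnegative on the selected half-spaces, the second by Cauchy-Schwarz.\<close>
    have pos: "0 \<le> N + (1 - N) * v j - (v j)\<^sup>2" if "j \<in> S \<union> K" for j
    proof -
      have j: "j \<in> J" using that S K by auto
      have "\<bar>v j\<bar> \<le> sqrt (ip n (u j) (u j)) * N" unfolding v_def N_def by (rule ip_le_sqrt)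
      also have "\<dots> \<le> 1 * N" using u_le[OF j] N by (intro mult_right_mono) auto
      finally have "0 \<le> N + v j" by simp
      moreover have "0 \<le> 1 - v j" using x[OF that] by (simp add: v_def)
      ultimately have "0 \<le> (1 - v j) * (N + v j)" by simp
      then show ?thesis by (simp add: algebra_simps power2_eq_square)
    qed
    have "0 \<le> (\<Sum>j\<in>J. c j * (N + (1 - N) * v j - (v j)\<^sup>2))"
    proof (rule sum_nonneg)
      fix j assume "j \<in> J"
      then show "0 \<le> c j * (N + (1 - N) * v j - (v j)\<^sup>2)"
        using c pos by (cases "j \<in> S") auto
    qed
    also have "\<dots> = N * sum c J + (1 - N) * (\<Sum>j\<in>J. c j * v j) - (\<Sum>j\<in>J. c j * (v j)\<^sup>2)"
      by (simp add: algebra_simps sum.distrib sum_subtractf sum_distrib_left)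
    also have "(\<Sum>j\<in>J. c j * v j) = ip n y x"
      unfolding v_def y_def moment_def by (rule ip_sum_left[symmetric])
    finally have 1: "(\<Sum>j\<in>J. c j * (v j)\<^sup>2) \<le> N * sum c J + (1 - N) * ip n y x" by simp
    have "0 \<le> (\<Sum>j\<in>K. f j * (N + (1 - N) * v j - (v j)\<^sup>2))"
      using K pos by (intro sum_nonneg) auto
    also have "\<dots> = N * sum f K + (1 - N) * (\<Sum>j\<in>K. f j * v j) - (\<Sum>j\<in>K. f j * (v j)\<^sup>2)"
      by (simp add: algebra_simps sum.distrib sum_subtractf sum_distrib_left)
    also have "\<dots> \<le> N * sum f K + (1 - N) * (\<Sum>j\<in>K. f j * v j)"
      using K by (auto intro!: sum_nonneg)
    also have "(\<Sum>j\<in>K. f j * v j) = ip n (\<lambda>i. \<Sum>j\<in>K. f j * u j i) x"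
      unfolding v_def by (rule ip_sum_left[symmetric])
    also have "\<dots> = ip n (\<lambda>i. (- 1) * y i) x" using K(5) eu by (intro ip_cong) auto
    also have "\<dots> = - ip n y x" unfolding ip_scale_left by simp
    finally have 2: "0 \<le> N * sum e J + (1 - N) * (- ip n y x)" using K(4) by simp
    \<comment> \<open>Adding the two estimates cancels the terms with
      \<open>ip n y x\<close>.\<close>
    have "real s / (16 * real n) * (N * N) \<le> N * sum c J + N * sum e J"
      using form[of x] 1 2 unfolding N(2) v_def by (simp add: algebra_simps)
    also have "\<dots> \<le> N * (real s + 2 * real n * sqrt (2 * real s))"
    proof -
      have "sum e J \<le> 2 * real n * sqrt (2 * real s)"
        unfolding se y_def using mom by (intro mult_left_mono) auto
      then have "sum c J + sum e J \<le> real s + 2 * real n * sqrt (2 * real s)" using c(3) by simp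
      then have "N * (sum c J + sum e J) \<le> N * (real s + 2 * real n * sqrt (2 * real s))"
        by (rule mult_left_mono[OF _ N(1)])
      then show ?thesis by (simp add: algebra_simps)
    qed
    finally have h: "(real s / (16 * real n) * N) * N \<le> (real s + 2 * real n * sqrt (2 * real s)) * N"
      by (simp add: algebra_simps)
    have "N \<le> 16 * real n + 32 * (real n)\<^sup>2 * sqrt (2 * real s) / real s"
    proof (cases "N = 0")
      case True
      then show ?thesis by simp
    next
      case False
      then have "real s / (16 * real n) * N \<le> real s + 2 * real n * sqrt (2 * real s)"
        using mult_right_le_imp_le[OF h] N(1) by simp
      then have "16 * real n / real s * (real s / (16 * real n) * N)
          \<le> 16 * real n / real s * (real s + 2 * real n * sqrt (2 * real s))"
        by (rule mult_left_mono) simp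
      then show ?thesis using s n_pos by (simp add: field_simps power2_eq_square)
    qed
    then show ?thesis by (simp add: N_def)
  qed
  \<comment> \<open>Without vectors the second moment would vanish at a unit vector, against its
    lower bound.\<close>
  have "S \<noteq> {}"
  proof
    assume "S = {}"
    then have "(\<Sum>l\<in>J. c l * (ip n (u l) (unit_vec 0))\<^sup>2) = 0" using c(2) by simp
    then have "real s / (16 * real n) * ip n (unit_vec 0) (unit_vec 0) \<le> 0"
      using form[of "unit_vec 0"] by simp
    moreover have "ip n (unit_vec 0) (unit_vec 0) = 1"
      using n_pos by (simp add: ip_unit_vec) (simp add: unit_vec_def)
    ultimately show False using s n_pos by (simp add: field_simps)
  qed
  moreover have "card (S \<union> K) \<le> s + n + 1"
    using card_Un_le[of S K] S K by simp
  ultimately show ?thesis using that[of "S \<union> K"] S K bound by auto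
qed

end

section \<open>The optimal ellipsoid in a polytope\<close>

lemma compact_coordinatewise:
  fixes B :: "nat \<Rightarrow> 'a::topological_space set"
  assumes "\<And>i. compact (B i)"
  shows "compact {x. \<forall>i. x i \<in> B i}"
proof -
  have "compactin (product_topology (\<lambda>i. euclidean) UNIV) (PiE UNIV B)"
    unfolding compactin_PiE using assms by simp
  then have "compact (PiE UNIV B)"
    by (simp add: euclidean_product_topology)
  also have "PiE UNIV B = {x. \<forall>i. x i \<in> B i}" by auto
  finally show ?thesis .
qed

lemma continuous_on_ip [continuous_intros]:
  assumes "\<And>i. i < n \<Longrightarrow> continuous_on S (\<lambda>x. f x i)" "\<And>i. i < n \<Longrightarrow> continuous_on S (\<lambda>x. g x i)"
  shows "continuous_on S (\<lambda>x. ip n (f x) (g x))"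
  unfolding ip_def by (intro continuous_intros assms) auto

text \<open>Forward substitution shows by induction on the row that the kernel is trivial.\<close>

lemma lower_triangular_surjective:
  assumes "\<And>i k. i < k \<Longrightarrow> T i k = 0" "\<And>i. i < n \<Longrightarrow> T i i \<noteq> 0"
  shows "\<exists>x. \<forall>i<n. mv n T x i = e i"
proof (rule injective_imp_surjective)
  fix x i
  assume z: "\<And>i. i < n \<Longrightarrow> mv n T x i = 0" and "i < n"
  show "x i = 0" using \<open>i < n\<close>
  proof (induction i rule: less_induct)
    case (less i)
    have "mv n T x i = (\<Sum>j<n. if j = i then T i i * x i else 0)"
      unfolding mv_def
    proof (rule sum.cong)
      fix j assume "j \<in> {..<n}"
      then show "T i j * x j = (if j = i then T i i * x i else 0)"
        using less.IH[of j] assms(1)[of i j] by (cases j i rule: linorder_cases) auto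
    qed simp
    then show ?case using z[OF less.prems] assms(2)[OF less.prems] less.prems by simp
  qed
qed

text \<open>The transpose of \<open>T\<close> applied to \<open>a\<close>: the normal of a
  half-space pulled back along \<open>T\<close>.\<close>

definition rvec :: "nat \<Rightarrow> (nat \<Rightarrow> real) \<Rightarrow> (nat \<Rightarrow> nat \<Rightarrow> real) \<Rightarrow> nat \<Rightarrow> real"
  where "rvec n a T = (\<lambda>k. \<Sum>i<n. a i * T i k)"

lemma ip_mv: "ip n a (mv n T x) = ip n (rvec n a T) x"
proof -
  have "ip n a (mv n T x) = (\<Sum>i<n. \<Sum>k<n. a i * T i k * x k)"
    by (simp add: ip_def mv_def sum_distrib_left mult.assoc)
  also have "\<dots> = (\<Sum>k<n. \<Sum>i<n. a i * T i k * x k)" by (rule sum.swap)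
  also have "\<dots> = ip n (rvec n a T) x" by (simp add: ip_def rvec_def sum_distrib_right)
  finally show ?thesis .
qed

lemma rvec_add: "rvec n a (\<lambda>i k. T i k + \<epsilon> * D i k) k = rvec n a T k + \<epsilon> * rvec n a D k"
  by (simp add: rvec_def distrib_left sum.distrib sum_distrib_left mult_ac)

lemma finite_positive_near_zero:
  fixes f :: "'b \<Rightarrow> real \<Rightarrow> real"
  assumes "finite J" "\<And>j. j \<in> J \<Longrightarrow> isCont (f j) 0" "\<And>j. j \<in> J \<Longrightarrow> 0 < f j 0"
  shows "eventually (\<lambda>\<epsilon>. \<forall>j\<in>J. 0 < f j \<epsilon>) (nhds 0)"
proof -
  have "\<forall>j\<in>J. eventually (\<lambda>\<epsilon>. 0 < f j \<epsilon>) (nhds 0)"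
    using assms(2,3) by (auto simp: isCont_def tendsto_at_iff_tendsto_nhds dest: order_tendstoD(1))
  then show ?thesis using assms(1) by (simp add: eventually_ball_finite)
qed

text \<open>The bound \<open>R\<close> makes the set of inscribed ellipsoids compact, and the
  strictly interior point \<open>p\<close> supplies a nondegenerate one.\<close>

locale polytope =
  fixes n :: nat and J :: "'b set" and a :: "'b \<Rightarrow> nat \<Rightarrow> real" and \<beta> :: "'b \<Rightarrow> real"
    and R :: real and p :: "nat \<Rightarrow> real"
  assumes n_pos: "0 < n" and fin: "finite J"
    and bounded: "\<And>z i. (\<And>j. j \<in> J \<Longrightarrow> ip n (a j) z \<le> \<beta> j) \<Longrightarrow> i < n \<Longrightarrow> \<bar>z i\<bar> \<le> R"
    and interior: "\<And>j. j \<in> J \<Longrightarrow> ip n (a j) p < \<beta> j"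
begin

text \<open>The support function of \<open>T B\<close> in the direction \<open>a j\<close> is the
  length of \<open>rvec n (a j) T\<close>. For a center in the half-space, a nonnegative slack thus
  says that \<open>z + T B\<close> lies in it; squaring makes the condition polynomial.\<close>

abbreviation slack :: "(nat \<Rightarrow> nat \<Rightarrow> real) \<Rightarrow> (nat \<Rightarrow> real) \<Rightarrow> 'b \<Rightarrow> real"
  where "slack T z j \<equiv> (\<beta> j - ip n (a j) z)\<^sup>2 - ip n (rvec n (a j) T) (rvec n (a j) T)"

text \<open>For triangular matrices the determinant is the product of the diagonal. Entries outside
  the \<open>n\<close> by \<open>n\<close> block vanish, which keeps the set of ellipsoids compact
  in the product topology.\<close>

definition lower :: "(nat \<Rightarrow> nat \<Rightarrow> real) \<Rightarrow> bool"
  where "lower T \<longleftrightarrow> (\<forall>i k. i < n \<and> k \<le> i \<or> T i k = 0)"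

text \<open>The ellipsoids \<open>z + T B\<close>, with \<open>B\<close> the unit ball, that lie in the polytope.\<close>

definition feasible :: "((nat \<Rightarrow> nat \<Rightarrow> real) \<times> (nat \<Rightarrow> real)) set"
  where "feasible = {(T, z). lower T \<and> (\<forall>i<n. 0 \<le> T i i) \<and> (\<forall>i\<ge>n. z i = 0) \<and>
    (\<forall>j\<in>J. 0 \<le> \<beta> j - ip n (a j) z \<and> 0 \<le> slack T z j)}"

text \<open>
  The exponents balance the volume term against the slack terms so that the weights in the
  first-order conditions have total mass exactly \<open>2n\<close>.
\<close>

definition objective :: "(nat \<Rightarrow> nat \<Rightarrow> real) \<times> (nat \<Rightarrow> real) \<Rightarrow> real"
  where "objective X =
    (\<Prod>i<n. (fst X i i) ^ (2 * card J)) * (\<Prod>j\<in>J. (slack (fst X) (snd X) j) ^ n)"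

lemma J_nonempty: "J \<noteq> {}"
proof
  assume "J = {}"
  then have "\<bar>\<bar>R\<bar> + 1\<bar> \<le> R" using bounded[of "\<lambda>_. \<bar>R\<bar> + 1" 0] n_pos by simp
  then show False by simp
qed

lemma feasible_contains_ellipsoid:
  assumes "(T, z) \<in> feasible" "ip n v v \<le> 1" "j \<in> J"
  shows "ip n (a j) (\<lambda>i. z i + mv n T v i) \<le> \<beta> j"
proof -
  let ?y = "rvec n (a j) T"
  have d: "0 \<le> \<beta> j - ip n (a j) z" "ip n ?y ?y \<le> (\<beta> j - ip n (a j) z)\<^sup>2"
    using assms by (auto simp: feasible_def)
  have "ip n ?y v \<le> sqrt (ip n ?y ?y) * sqrt (ip n v v)"
    using ip_le_sqrt[of n ?y v] by linarith
  also have "\<dots> \<le> sqrt ((\<beta> j - ip n (a j) z)\<^sup>2) * 1"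
    using d assms(2) by (intro mult_mono real_sqrt_le_mono) auto
  also have "\<dots> = \<beta> j - ip n (a j) z" using d(1) by simp
  finally show ?thesis by (simp add: ip_add_right ip_mv)
qed

text \<open>The points \<open>z\<close> and \<open>z + T e_k\<close> lie in the polytope, and
  \<open>T i k\<close> is the difference of their coordinates at \<open>i\<close>.\<close>

lemma feasible_bounded:
  assumes "(T, z) \<in> feasible"
  shows "\<bar>z i\<bar> \<le> \<bar>R\<bar>" "\<bar>T i k\<bar> \<le> 2 * \<bar>R\<bar>"
proof -
  have z: "\<bar>z i\<bar> \<le> \<bar>R\<bar>" for i
  proof (cases "i < n")
    case True
    have "\<bar>z i\<bar> \<le> R" using assms True by (intro bounded) (auto simp: feasible_def)
    then show ?thesis by simp
  next
    case False
    then show ?thesis using assms by (simp add: feasible_def)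
  qed
  then show "\<bar>z i\<bar> \<le> \<bar>R\<bar>" .
  show "\<bar>T i k\<bar> \<le> 2 * \<bar>R\<bar>"
  proof (cases "T i k = 0")
    case True
    then show ?thesis by simp
  next
    case False
    then have "i < n \<and> k \<le> i" using assms unfolding feasible_def lower_def by blast
    then have ik: "i < n" "k < n" by auto
    have "ip n (unit_vec k) (unit_vec k) = 1" using ik by (simp add: ip_unit_vec) (simp add: unit_vec_def)
    then have "\<bar>z i + mv n T (unit_vec k) i\<bar> \<le> R"
      using feasible_contains_ellipsoid[OF assms, of "unit_vec k"] ik
      by (intro bounded) auto
    then show ?thesis using z[of i] ik by (simp add: mv_unit_vec)
  qed
qed

lemma continuous_coordinates:
  "continuous_on S (\<lambda>X :: (nat \<Rightarrow> nat \<Rightarrow> real) \<times> (nat \<Rightarrow> real). fst X i k)"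
  "continuous_on S (\<lambda>X :: (nat \<Rightarrow> nat \<Rightarrow> real) \<times> (nat \<Rightarrow> real). snd X i)"
   apply (intro continuous_on_product_then_coordinatewise[of S "\<lambda>X. fst X i"]
      continuous_on_product_then_coordinatewise[of S fst] continuous_on_fst continuous_on_id)
  apply (intro continuous_on_product_then_coordinatewise[of S snd] continuous_on_snd continuous_on_id)
  done

lemma continuous_slack: "continuous_on S (\<lambda>X. slack (fst X) (snd X) j)"
  unfolding rvec_def by (intro continuous_intros continuous_coordinates)

lemma compact_feasible: "compact feasible"
proof -
  let ?A = "{T :: nat \<Rightarrow> nat \<Rightarrow> real. \<forall>i. T i \<in> {x. \<forall>k. x k \<in> {- 2 * \<bar>R\<bar> .. 2 * \<bar>R\<bar>}}}"
  let ?B = "{z :: nat \<Rightarrow> real. \<forall>i. z i \<in> {- \<bar>R\<bar> .. \<bar>R\<bar>}}"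
  have "compact {x :: nat \<Rightarrow> real. \<forall>k. x k \<in> {- 2 * \<bar>R\<bar> .. 2 * \<bar>R\<bar>}}" "compact ?B"
    by (rule compact_coordinatewise, rule compact_Icc)+
  then have "compact (?A \<times> ?B)"
    by (intro compact_Times compact_coordinatewise) auto
  moreover have "feasible \<subseteq> ?A \<times> ?B"
  proof
    fix X assume X: "X \<in> feasible"
    obtain T z where "X = (T, z)" by (cases X)
    then show "X \<in> ?A \<times> ?B"
      using feasible_bounded[of T z] X by (simp add: abs_le_iff minus_le_iff)
  qed
  moreover have "closed feasible"
  proof -
    have "feasible = {X. (\<forall>i k. i < n \<and> k \<le> i \<or> fst X i k = 0) \<and> (\<forall>i. i < n \<longrightarrow> 0 \<le> fst X i i) \<and>
        (\<forall>i. i \<ge> n \<longrightarrow> snd X i = 0) \<and>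
        (\<forall>j. j \<in> J \<longrightarrow> 0 \<le> \<beta> j - ip n (a j) (snd X) \<and> 0 \<le> slack (fst X) (snd X) j)}"
      unfolding feasible_def lower_def by (simp add: case_prod_unfold Ball_def)
    also have "closed \<dots>"
      by (intro closed_Collect_conj closed_Collect_all closed_Collect_imp closed_Collect_disj
          closed_Collect_le closed_Collect_eq continuous_intros continuous_coordinates
          continuous_slack closed_Collect_const open_Collect_const)
    finally show ?thesis .
  qed
  ultimately show ?thesis using compact_Int_closed[of "?A \<times> ?B" feasible]
    by (simp add: Int_absorb1)
qed

text \<open>A small ball about \<open>p\<close> serves as witness; it forces the maximiser to be
  nondegenerate.\<close>

lemma feasible_positive: "\<exists>X\<in>feasible. 0 < objective X"
proof -
  \<comment> \<open>Feasible centers vanish from index \<open>n\<close> on, so \<open>p\<close> is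
    truncated.\<close>
  define q where "q i = (if i < n then p i else 0)" for i
  have q: "ip n (a j) q < \<beta> j" if "j \<in> J" for j
    using interior[OF that] by (simp add: ip_def q_def)
  define D where "D i k = (if i < n \<and> i = k then 1 else 0 :: real)" for i k :: nat
  have "eventually (\<lambda>\<epsilon>. \<forall>j\<in>J. 0 < slack (\<lambda>i k. 0 + \<epsilon> * D i k) q j) (nhds 0)"
  proof (rule finite_positive_near_zero[OF fin])
    fix j assume "j \<in> J"
    show "isCont (\<lambda>\<epsilon>. slack (\<lambda>i k. 0 + \<epsilon> * D i k) q j) 0"
      unfolding ip_def rvec_def by (intro continuous_intros)
    show "0 < slack (\<lambda>i k. 0 + 0 * D i k) q j"
      using q[OF \<open>j \<in> J\<close>] by (simp add: ip_def rvec_def)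
  qed
  then obtain d where d: "0 < d" "\<And>\<epsilon>. dist \<epsilon> 0 < d \<Longrightarrow> \<forall>j\<in>J. 0 < slack (\<lambda>i k. 0 + \<epsilon> * D i k) q j"
    unfolding eventually_nhds_metric by blast
  define T where "T = (\<lambda>i k. 0 + d / 2 * D i k)"
  have s: "\<forall>j\<in>J. 0 < slack T q j" unfolding T_def using d(1) by (intro d(2)) simp
  have t: "0 < T i i" if "i < n" for i using that d(1) by (simp add: T_def D_def)
  have "(T, q) \<in> feasible"
    using s t d(1) q by (auto simp: feasible_def lower_def T_def D_def q_def less_imp_le)
  moreover have "0 < objective (T, q)"
    unfolding objective_def using s t d(1) by (intro mult_pos_pos prod_pos) auto
  ultimately show ?thesis by blast
qed

text \<open>A maximiser exists by compactness. Its objective is positive and both exponents are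
  positive, so no diagonal entry and no slack can vanish.\<close>

lemma optimal_ellipsoid:
  obtains T z where "(T, z) \<in> feasible" "\<And>i. i < n \<Longrightarrow> 0 < T i i"
    "\<And>j. j \<in> J \<Longrightarrow> 0 < slack T z j" "\<And>X. X \<in> feasible \<Longrightarrow> objective X \<le> objective (T, z)"
proof -
  have "continuous_on feasible objective"
    unfolding objective_def by (intro continuous_intros continuous_coordinates continuous_slack)
  then obtain X where X: "X \<in> feasible" "\<And>Y. Y \<in> feasible \<Longrightarrow> objective Y \<le> objective X"
    using continuous_attains_sup[OF compact_feasible, of objective] feasible_positive by blast
  obtain T z where Tz: "X = (T, z)" by (cases X)
  have pos: "0 < objective (T, z)" using feasible_positive X Tz by force
  have c: "0 < card J" using fin J_nonempty by (simp add: card_gt_0_iff)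
  have "T i i \<noteq> 0" if "i < n" for i
  proof
    assume "T i i = 0"
    then have *: "(\<Prod>i<n. T i i ^ (2 * card J)) = 0" using that c by (intro prod_zero) auto
    show False using pos unfolding objective_def fst_conv snd_conv * by simp
  qed
  moreover have "slack T z j \<noteq> 0" if "j \<in> J" for j
  proof
    assume "slack T z j = 0"
    then have *: "(\<Prod>j\<in>J. slack T z j ^ n) = 0" using that n_pos fin by (intro prod_zero) auto
    show False using pos unfolding objective_def fst_conv snd_conv * by simp
  qed
  ultimately show ?thesis
    using that[of T z] X unfolding Tz
    by (force simp: feasible_def less_le)
qed

text \<open>The first variation of the logarithm of the objective in the direction
  \<open>(D, h)\<close> vanishes: the constraints hold strictly, so small perturbations of either
  sign are feasible.\<close>

lemma optimal_stationary:
  assumes feas: "(T, z) \<in> feasible" and diag: "\<And>i. i < n \<Longrightarrow> 0 < T i i"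
    and slack: "\<And>j. j \<in> J \<Longrightarrow> 0 < slack T z j"
    and opt: "\<And>X. X \<in> feasible \<Longrightarrow> objective X \<le> objective (T, z)"
    and D: "lower D" and h: "\<And>i. i \<ge> n \<Longrightarrow> h i = 0"
  shows "real (card J) * (\<Sum>i<n. D i i / T i i) =
    real n * (\<Sum>j\<in>J. ((\<beta> j - ip n (a j) z) * ip n (a j) h
      + ip n (rvec n (a j) T) (rvec n (a j) D)) / slack T z j)"
proof -
  define Te where "Te \<epsilon> = (\<lambda>i k. T i k + \<epsilon> * D i k)" for \<epsilon>
  define ze where "ze \<epsilon> = (\<lambda>i. z i + \<epsilon> * h i)" for \<epsilon>
  define d where "d j = \<beta> j - ip n (a j) z" for j
  define y where "y j = rvec n (a j) T" for j
  define g where "g j = rvec n (a j) D" for j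
  define b where "b j = ip n (a j) h" for j
  \<comment> \<open>The slack along the perturbation, expanded in powers of
    \<open>\<epsilon>\<close> for differentiation.\<close>
  define \<sigma> where "\<sigma> j \<epsilon> = (d j - \<epsilon> * b j)\<^sup>2 - (ip n (y j) (y j) + 2 * \<epsilon> * ip n (y j) (g j)
    + \<epsilon>\<^sup>2 * ip n (g j) (g j))" for j \<epsilon>
  have \<sigma>: "slack (Te \<epsilon>) (ze \<epsilon>) j = \<sigma> j \<epsilon>" for \<epsilon> j
  proof -
    have e1: "rvec n (a j) (Te \<epsilon>) = (\<lambda>k. y j k + \<epsilon> * g j k)"
      by (rule ext) (simp add: Te_def rvec_add y_def g_def)
    have e2: "\<beta> j - ip n (a j) (ze \<epsilon>) = d j - \<epsilon> * b j"
      by (simp add: ze_def d_def b_def ip_linear)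
    show ?thesis unfolding e1 e2
      by (simp add: \<sigma>_def ip_linear ip_commute[of n "g j" "y j"] power2_eq_square algebra_simps)
  qed
  have d0: "0 < d j" if "j \<in> J" for j
  proof -
    have "0 \<le> d j" using feas that by (auto simp: feasible_def d_def)
    moreover have "d j \<noteq> 0"
    proof
      assume "d j = 0"
      then have "ip n (rvec n (a j) T) (rvec n (a j) T) < 0" using slack[OF that] by (simp add: d_def)
      then show False using ip_self_nonneg[of n "rvec n (a j) T"] by linarith
    qed
    ultimately show ?thesis by simp
  qed
  have \<sigma>0: "\<sigma> j 0 = slack T z j" for j by (simp add: \<sigma>_def d_def y_def)
  have "eventually (\<lambda>\<epsilon>. \<forall>j\<in>J. 0 < \<sigma> j \<epsilon>) (nhds 0)"
  proof (rule finite_positive_near_zero[OF fin])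
    show "isCont (\<sigma> j) 0" for j unfolding \<sigma>_def[abs_def] by (intro continuous_intros)
    show "0 < \<sigma> j 0" if "j \<in> J" for j unfolding \<sigma>0 by (rule slack[OF that])
  qed
  moreover have "eventually (\<lambda>\<epsilon>. \<forall>j\<in>J. 0 < d j - \<epsilon> * b j) (nhds 0)"
  proof (rule finite_positive_near_zero[OF fin])
    show "isCont (\<lambda>\<epsilon>. d j - \<epsilon> * b j) 0" for j by (intro continuous_intros)
  qed (simp add: d0)
  moreover have "eventually (\<lambda>\<epsilon>. \<forall>i\<in>{..<n}. 0 < T i i + \<epsilon> * D i i) (nhds 0)"
  proof (rule finite_positive_near_zero)
    show "isCont (\<lambda>\<epsilon>. T i i + \<epsilon> * D i i) 0" for i by (intro continuous_intros)
  qed (simp_all add: diag)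
  ultimately have "eventually (\<lambda>\<epsilon>. (\<forall>j\<in>J. 0 < \<sigma> j \<epsilon>) \<and> (\<forall>j\<in>J. 0 < d j - \<epsilon> * b j) \<and>
      (\<forall>i\<in>{..<n}. 0 < T i i + \<epsilon> * D i i)) (nhds 0)"
    by eventually_elim blast
  then obtain r where r: "0 < r" "\<And>\<epsilon>. dist \<epsilon> 0 < r \<Longrightarrow> (\<forall>j\<in>J. 0 < \<sigma> j \<epsilon>) \<and> (\<forall>j\<in>J. 0 < d j - \<epsilon> * b j) \<and>
      (\<forall>i\<in>{..<n}. 0 < T i i + \<epsilon> * D i i)"
    unfolding eventually_nhds_metric by blast
  have r\<sigma>: "0 < \<sigma> j \<epsilon>" if "dist \<epsilon> 0 < r" "j \<in> J" for j \<epsilon> using r(2) that by blast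
  have rd: "0 < d j - \<epsilon> * b j" if "dist \<epsilon> 0 < r" "j \<in> J" for j \<epsilon> using r(2) that by blast
  have rT: "0 < T i i + \<epsilon> * D i i" if "dist \<epsilon> 0 < r" "i < n" for i \<epsilon> using r(2) that by blast
  define L where "L \<epsilon> = 2 * real (card J) * (\<Sum>i<n. ln (T i i + \<epsilon> * D i i)) + real n * (\<Sum>j\<in>J. ln (\<sigma> j \<epsilon>))" for \<epsilon>
  have obj: "objective (Te \<epsilon>, ze \<epsilon>) = (\<Prod>i<n. (T i i + \<epsilon> * D i i) ^ (2 * card J)) * (\<Prod>j\<in>J. \<sigma> j \<epsilon> ^ n)" for \<epsilon>
    by (simp add: objective_def \<sigma>) (simp add: Te_def)
  have pos: "0 < objective (Te \<epsilon>, ze \<epsilon>)" if "dist \<epsilon> 0 < r" for \<epsilon>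
    unfolding obj
    by (intro mult_pos_pos prod_pos zero_less_power r\<sigma>[OF that] rT[OF that]) auto
  have L: "ln (objective (Te \<epsilon>, ze \<epsilon>)) = L \<epsilon>" if "dist \<epsilon> 0 < r" for \<epsilon>
  proof -
    have nzT: "T i i + \<epsilon> * D i i \<noteq> 0" if "i < n" for i
      using rT[OF \<open>dist \<epsilon> 0 < r\<close> that] by simp
    have nz\<sigma>: "\<sigma> j \<epsilon> \<noteq> 0" if "j \<in> J" for j
      using r\<sigma>[OF \<open>dist \<epsilon> 0 < r\<close> that] by simp
    have 1: "0 < (\<Prod>i<n. (T i i + \<epsilon> * D i i) ^ (2 * card J))"
      by (intro prod_pos zero_less_power rT[OF that]) simp
    have p2: "0 < (\<Prod>j\<in>J. \<sigma> j \<epsilon> ^ n)"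
      by (intro prod_pos zero_less_power r\<sigma>[OF that]) simp
    have "ln (\<Prod>i<n. (T i i + \<epsilon> * D i i) ^ (2 * card J)) = (\<Sum>i<n. ln ((T i i + \<epsilon> * D i i) ^ (2 * card J)))"
      by (rule ln_prod) (simp_all add: nzT)
    also have "\<dots> = (\<Sum>i<n. 2 * real (card J) * ln (T i i + \<epsilon> * D i i))"
      using rT[OF that] by (intro sum.cong refl) (simp add: ln_realpow)
    finally have 2: "ln (\<Prod>i<n. (T i i + \<epsilon> * D i i) ^ (2 * card J))
      = 2 * real (card J) * (\<Sum>i<n. ln (T i i + \<epsilon> * D i i))" by (simp add: sum_distrib_left)
    have "ln (\<Prod>j\<in>J. \<sigma> j \<epsilon> ^ n) = (\<Sum>j\<in>J. ln (\<sigma> j \<epsilon> ^ n))"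
      by (rule ln_prod) (simp_all add: nz\<sigma> fin)
    also have "\<dots> = (\<Sum>j\<in>J. real n * ln (\<sigma> j \<epsilon>))"
      using r\<sigma>[OF that] by (intro sum.cong refl) (simp add: ln_realpow)
    finally have 3: "ln (\<Prod>j\<in>J. \<sigma> j \<epsilon> ^ n) = real n * (\<Sum>j\<in>J. ln (\<sigma> j \<epsilon>))"
      by (simp add: sum_distrib_left)
    show ?thesis unfolding obj ln_mult_pos[OF 1 p2] 2 3 L_def ..
  qed
  have max: "L \<epsilon> \<le> L 0" if \<epsilon>: "dist \<epsilon> 0 < r" for \<epsilon>
  proof -
    have "(Te \<epsilon>, ze \<epsilon>) \<in> feasible"
      unfolding feasible_def mem_Collect_eq prod.case
    proof (intro conjI allI impI ballI)
      have "i < n \<and> k \<le> i \<or> T i k = 0" "i < n \<and> k \<le> i \<or> D i k = 0" for i k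
        using feas D unfolding feasible_def lower_def by blast+
      then show "lower (Te \<epsilon>)" unfolding lower_def Te_def by (metis add.right_neutral mult_zero_right)
      show "0 \<le> Te \<epsilon> i i" if "i < n" for i
        using rT[OF \<epsilon> that] by (simp add: Te_def less_imp_le)
      show "ze \<epsilon> i = 0" if "n \<le> i" for i using h that feas by (simp add: ze_def feasible_def)
      have "\<beta> j - ip n (a j) (ze \<epsilon>) = d j - \<epsilon> * b j" for j by (simp add: ze_def d_def b_def ip_linear)
      then show "0 \<le> \<beta> j - ip n (a j) (ze \<epsilon>)" if "j \<in> J" for j using rd[OF \<epsilon> that] by (metis less_imp_le)
      show "0 \<le> slack (Te \<epsilon>) (ze \<epsilon>) j" if "j \<in> J" for j
        unfolding \<sigma> using r\<sigma>[OF \<epsilon> that] by (rule less_imp_le)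
    qed
    then have "objective (Te \<epsilon>, ze \<epsilon>) \<le> objective (T, z)" by (rule opt)
    also have "(T, z) = (Te 0, ze 0)" by (simp add: Te_def ze_def)
    finally have "ln (objective (Te \<epsilon>, ze \<epsilon>)) \<le> ln (objective (Te 0, ze 0))"
      using pos[OF \<epsilon>] by simp
    then show ?thesis using L[OF \<epsilon>] L[of 0] r(1) by simp
  qed
  have "(L has_real_derivative
      2 * real (card J) * (\<Sum>i<n. D i i / T i i)
      + real n * (\<Sum>j\<in>J. (- 2 * (d j * b j + ip n (y j) (g j))) / \<sigma> j 0)) (at 0)"
  proof -
    have "((\<lambda>\<epsilon>. ln (\<sigma> j \<epsilon>)) has_real_derivative (- 2 * (d j * b j + ip n (y j) (g j))) / \<sigma> j 0) (at 0)"
      if "j \<in> J" for j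
    proof -
      have "(\<sigma> j has_real_derivative - 2 * (d j * b j + ip n (y j) (g j))) (at 0)"
        unfolding \<sigma>_def[abs_def] by (auto intro!: derivative_eq_intros simp: algebra_simps)
      then show ?thesis using slack[OF that] unfolding \<sigma>0[symmetric]
        by (auto intro!: derivative_eq_intros)
    qed
    moreover have "((\<lambda>\<epsilon>. ln (T i i + \<epsilon> * D i i)) has_real_derivative D i i / T i i) (at 0)"
      if "i < n" for i
      using diag[OF that] by (auto intro!: derivative_eq_intros)
    ultimately show ?thesis
      unfolding L_def[abs_def]
      by (intro DERIV_add DERIV_cmult DERIV_sum) auto
  qed
  then have "2 * real (card J) * (\<Sum>i<n. D i i / T i i)
      + real n * (\<Sum>j\<in>J. (- 2 * (d j * b j + ip n (y j) (g j))) / \<sigma> j 0) = 0"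
    using max by (intro DERIV_local_max[of L _ 0 r] r(1)) (auto simp: dist_real_def)
  moreover have "(\<Sum>j\<in>J. (- 2 * (d j * b j + ip n (y j) (g j))) / \<sigma> j 0)
      = - 2 * (\<Sum>j\<in>J. (d j * b j + ip n (y j) (g j)) / \<sigma> j 0)"
    unfolding sum_distrib_left by (intro sum.cong) auto
  ultimately show ?thesis unfolding \<sigma>0 d_def b_def y_def g_def by simp
qed

end

section \<open>John position and polytope approximation\<close>

context polytope
begin

text \<open>Stationarity under translations gives centering, stationarity in \<open>T\<close> gives
  isotropy, and positive slacks give vectors shorter than one.\<close>

lemma john_position:
  obtains T z w where "(T, z) \<in> feasible" "\<And>i. i < n \<Longrightarrow> 0 < T i i"
    "\<And>j. j \<in> J \<Longrightarrow> 0 < \<beta> j - ip n (a j) z"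
    "john_weights n J w (\<lambda>j k. 1 / (\<beta> j - ip n (a j) z) * rvec n (a j) T k)"
proof -
  obtain T z where feas: "(T, z) \<in> feasible" and diag: "\<And>i. i < n \<Longrightarrow> 0 < T i i"
    and slack: "\<And>j. j \<in> J \<Longrightarrow> 0 < slack T z j"
    and opt: "\<And>X. X \<in> feasible \<Longrightarrow> objective X \<le> objective (T, z)"
    by (rule optimal_ellipsoid) blast
  note stat = optimal_stationary[OF feas diag slack opt]
  have low: "i < n \<and> k \<le> i \<or> T i k = 0" for i k
    using feas unfolding feasible_def lower_def by blast
  have T0: "T i k = 0" if "n \<le> i" for i k using low[of i k] that by simp
  define d where "d j = \<beta> j - ip n (a j) z" for j
  define y where "y j = rvec n (a j) T" for j
  define s where "s j = slack T z j" for j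
  define m where "m = real (card J)"
  define u where "u j k = 1 / d j * y j k" for j k
  define w where "w j = real n / m * ((d j)\<^sup>2 / s j)" for j
  have m: "0 < m" using fin J_nonempty by (simp add: m_def card_gt_0_iff)
  have s: "0 < s j" if "j \<in> J" for j using slack[OF that] by (simp add: s_def)
  have d: "0 < d j" if "j \<in> J" for j
  proof -
    have "0 \<le> d j" using feas that by (auto simp: feasible_def d_def)
    moreover have "0 < (d j)\<^sup>2" using slack[OF that] ip_self_nonneg[of n "y j"] unfolding d_def y_def by linarith
    ultimately show ?thesis by (simp add: less_le)
  qed
  have ipu: "(d j)\<^sup>2 * ip n (u j) (u j) = ip n (y j) (y j)" if "j \<in> J" for j
    unfolding u_def[abs_def] ip_scale_left ip_scale_right using d[OF that] by (simp add: power2_eq_square)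
  have s_eq: "s j = (d j)\<^sup>2 * (1 - ip n (u j) (u j))" if "j \<in> J" for j
    using ipu[OF that] by (simp add: s_def d_def y_def right_diff_distrib)
  have center: "(\<Sum>j\<in>J. w j * u j q) = 0" if "q < n" for q
  proof -
    \<comment> \<open>The center is varied along column \<open>q\<close> of \<open>T\<close> while
      \<open>T\<close> is fixed.\<close>
    have "ip n (a j) (\<lambda>i. T i q) = y j q" for j by (simp add: y_def rvec_def ip_def)
    moreover have "real (card J) * (\<Sum>i<n. (0::real) / T i i) = real n * (\<Sum>j\<in>J. (d j * ip n (a j) (\<lambda>i. T i q)
      + ip n (rvec n (a j) T) (rvec n (a j) (\<lambda>i k. 0))) / slack T z j)"
      unfolding d_def by (rule stat) (auto simp: lower_def T0)
    ultimately have "(\<Sum>j\<in>J. d j * y j q / s j) = 0"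
      using n_pos by (simp add: s_def rvec_def ip_def)
    moreover have "w j * u j q = real n / m * (d j * y j q / s j)" if "j \<in> J" for j
      using d[OF that] by (simp add: w_def u_def power2_eq_square)
    then have "(\<Sum>j\<in>J. w j * u j q) = real n / m * (\<Sum>j\<in>J. d j * y j q / s j)"
      by (simp add: sum_distrib_left)
    ultimately show ?thesis by simp
  qed
  have iso: "(\<Sum>j\<in>J. w j * (u j r * u j q)) = (if r = q then 1 else 0)" if rq: "r \<le> q" "q < n" for r q
  proof -
    \<comment> \<open>Column \<open>q\<close> of \<open>T\<close> is placed in column
      \<open>r\<close>, which stays lower triangular since \<open>r \<le> q\<close>. The volume term
      then contributes \<open>T r q / T r r\<close>, which vanishes for
      \<open>r < q\<close>.\<close>
    define D where "D i k = (if k = r then T i q else 0)" for i k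
    have "lower D" unfolding lower_def D_def using low rq by (metis le_trans)
    have Dd: "(\<Sum>i<n. D i i / T i i) = (if r = q then 1 else 0)"
    proof -
      have "(\<Sum>i<n. D i i / T i i) = (\<Sum>i<n. if i = r then T r q / T r r else 0)"
        by (rule sum.cong) (auto simp: D_def)
      also have "\<dots> = T r q / T r r" using rq by simp
      also have "\<dots> = (if r = q then 1 else 0)"
        using low[of r q] rq diag[of r] by auto
      finally show ?thesis .
    qed
    have "rvec n (a j) D = (\<lambda>k. y j q * (if k = r then 1 else 0))" for j
      by (rule ext) (simp add: rvec_def D_def y_def)
    then have Dy: "ip n (y j) (rvec n (a j) D) = y j r * y j q" for j
      using rq by (simp add: ip_def if_distrib cong: if_cong)
    have e: "(d j * ip n (a j) (\<lambda>i. 0) + ip n (rvec n (a j) T) (rvec n (a j) D)) / slack T z j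
        = y j r * y j q / s j" for j
    proof -
      have "ip n (a j) (\<lambda>i. 0) = 0" by (simp add: ip_def)
      then show ?thesis using Dy[of j] by (simp add: s_def y_def)
    qed
    have "real (card J) * (\<Sum>i<n. D i i / T i i) = real n * (\<Sum>j\<in>J. (d j * ip n (a j) (\<lambda>i. 0)
      + ip n (rvec n (a j) T) (rvec n (a j) D)) / slack T z j)"
      unfolding d_def by (rule stat) (use \<open>lower D\<close> in auto)
    then have "m * (if r = q then 1 else 0) = real n * (\<Sum>j\<in>J. y j r * y j q / s j)"
      unfolding Dd e m_def .
    moreover have "w j * (u j r * u j q) = real n / m * (y j r * y j q / s j)" if "j \<in> J" for j
      using d[OF that] by (simp add: w_def u_def power2_eq_square)
    then have "(\<Sum>j\<in>J. w j * (u j r * u j q)) = real n / m * (\<Sum>j\<in>J. y j r * y j q / s j)"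
      by (simp add: sum_distrib_left)
    ultimately have "m * (\<Sum>j\<in>J. w j * (u j r * u j q)) = m * (if r = q then 1 else 0)"
      using m by simp
    then show ?thesis using m by simp
  qed
  have iso': "(\<Sum>j\<in>J. w j * (u j r * u j q)) = (if r = q then 1 else 0)" if "r < n" "q < n" for r q
    using iso[of r q] iso[of q r] that by (cases "r \<le> q") (auto simp: mult.commute)
  have tot: "sum w J = 2 * real n"
  proof -
    \<comment> \<open>The choice of \<open>w\<close> makes \<open>w j * (1 - |u j|^2)\<close> equal
      to \<open>n / m\<close>. Summing over the \<open>m\<close> indices yields \<open>n\<close>,
      and isotropy contributes another \<open>n\<close>.\<close>
    have "w j = real n / m + (\<Sum>k<n. w j * (u j k * u j k))" if j: "j \<in> J" for j
    proof -
      have "w j * (1 - ip n (u j) (u j)) = real n / m * ((d j)\<^sup>2 * (1 - ip n (u j) (u j)) / s j)"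
        by (simp add: w_def)
      also have "\<dots> = real n / m" unfolding s_eq[OF j, symmetric] using s[OF j] by simp
      finally have "w j * (1 - ip n (u j) (u j)) = real n / m" .
      then show ?thesis by (simp add: ip_def right_diff_distrib sum_distrib_left)
    qed
    then have "sum w J = (\<Sum>j\<in>J. real n / m + (\<Sum>k<n. w j * (u j k * u j k)))"
      by (rule sum.cong[OF refl])
    also have "\<dots> = (\<Sum>j\<in>J. real n / m) + (\<Sum>j\<in>J. \<Sum>k<n. w j * (u j k * u j k))"
      by (simp add: sum.distrib)
    also have "(\<Sum>j\<in>J. real n / m) = real n" using m by (simp add: m_def)
    also have "(\<Sum>j\<in>J. \<Sum>k<n. w j * (u j k * u j k)) = (\<Sum>k<n. \<Sum>j\<in>J. w j * (u j k * u j k))"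
      by (rule sum.swap)
    also have "\<dots> = real n" by (simp add: iso')
    finally show ?thesis by simp
  qed
  have "john_weights n J w u"
  proof
    show "0 \<le> w j" if "j \<in> J" for j
      unfolding w_def using m s[OF that] by (intro mult_nonneg_nonneg divide_nonneg_nonneg) auto
    show "ip n (u j) (u j) \<le> 1" if "j \<in> J" for j
      using s[OF that] d[OF that] unfolding s_eq[OF that] by (simp add: zero_less_mult_iff)
  qed (use n_pos fin iso' center tot in auto)
  then show ?thesis
    using that[OF feas diag, of w] d unfolding u_def[abs_def] d_def y_def by blast
qed

text \<open>In the coordinates \<open>x = z + T v\<close> the polar bound becomes an outer ellipsoid
  for the selected half-spaces: the inner ellipsoid enlarged by \<open>W\<close> about
  \<open>z\<close>.\<close>

lemma sparse_subpolytope: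
  assumes "32 * n \<le> s" and W: "W = 16 * real n + 32 * (real n)\<^sup>2 * sqrt (2 * real s) / real s"
  obtains S z T where "S \<subseteq> J" "S \<noteq> {}" "card S \<le> s + n + 1"
    "\<forall>i\<ge>n. z i = 0" "\<forall>i\<ge>n. \<forall>k. T i k = 0"
    "\<forall>v. ip n v v \<le> 1 \<longrightarrow> (\<forall>j\<in>J. ip n (a j) (\<lambda>i. z i + mv n T v i) \<le> \<beta> j)"
    "\<forall>x. (\<forall>j\<in>S. ip n (a j) x \<le> \<beta> j) \<longrightarrow>
      (\<exists>v. ip n v v \<le> 1 \<and> (\<forall>i<n. x i = z i + W * mv n T v i))"
proof -
  obtain T z w where feas: "(T, z) \<in> feasible" and diag: "\<And>i. i < n \<Longrightarrow> 0 < T i i"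
    and d: "\<And>j. j \<in> J \<Longrightarrow> 0 < \<beta> j - ip n (a j) z"
    and jw: "john_weights n J w (\<lambda>j k. 1 / (\<beta> j - ip n (a j) z) * rvec n (a j) T k)"
    by (rule john_position) blast
  have low: "i < n \<and> k \<le> i \<or> T i k = 0" for i k
    using feas unfolding feasible_def lower_def by blast
  obtain S where S: "S \<subseteq> J" "S \<noteq> {}" "card S \<le> s + n + 1"
    and bound: "\<And>x. (\<And>j. j \<in> S \<Longrightarrow> ip n (\<lambda>k. 1 / (\<beta> j - ip n (a j) z) * rvec n (a j) T k) x \<le> 1) \<Longrightarrow>
      sqrt (ip n x x) \<le> W"
    unfolding W by (rule john_weights.sparse_polar_bound[OF jw assms(1)]) blast
  have Wpos: "0 < W" unfolding W using n_pos by (intro add_pos_nonneg) auto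
  have ball: "\<exists>v. ip n v v \<le> 1 \<and> (\<forall>i<n. x i = z i + W * mv n T v i)"
    if x: "\<And>j. j \<in> S \<Longrightarrow> ip n (a j) x \<le> \<beta> j" for x
  proof -
    have "\<exists>v. \<forall>i<n. mv n T v i = x i - z i"
    proof (rule lower_triangular_surjective)
      show "T i k = 0" if "i < k" for i k using low[of i k] that by auto
      show "T i i \<noteq> 0" if "i < n" for i using diag[OF that] by simp
    qed
    then obtain v where v: "\<And>i. i < n \<Longrightarrow> mv n T v i = x i - z i" by blast
    have "sqrt (ip n v v) \<le> W"
    proof (rule bound)
      fix j assume j: "j \<in> S"
      have "ip n (rvec n (a j) T) v = ip n (a j) (\<lambda>i. x i - z i)"
        unfolding ip_mv[symmetric] by (rule ip_cong) (auto simp: v)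
      also have "\<dots> \<le> \<beta> j - ip n (a j) z" using x[OF j] by (simp add: ip_diff_right)
      finally show "ip n (\<lambda>k. 1 / (\<beta> j - ip n (a j) z) * rvec n (a j) T k) v \<le> 1"
        unfolding ip_scale_left using d[of j] S j by auto
    qed
    then have "ip n v v \<le> W\<^sup>2" using Wpos by (simp add: real_sqrt_le_iff' sqrt_le_D)
    then have "ip n (\<lambda>i. 1 / W * v i) (\<lambda>i. 1 / W * v i) \<le> 1"
      unfolding ip_scale_left ip_scale_right using Wpos by (simp add: field_simps power2_eq_square)
    moreover have "\<forall>i<n. x i = z i + W * mv n T (\<lambda>i. 1 / W * v i) i"
      unfolding mv_scale using v Wpos by simp
    ultimately show ?thesis by blast
  qed
  show ?thesis
  proof (rule that[OF S, of z T])
    show "\<forall>i\<ge>n. z i = 0" using feas by (simp add: feasible_def)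
    show "\<forall>i\<ge>n. \<forall>k. T i k = 0" using low by (metis not_le)
    show "\<forall>v. ip n v v \<le> 1 \<longrightarrow> (\<forall>j\<in>J. ip n (a j) (\<lambda>i. z i + mv n T v i) \<le> \<beta> j)"
      using feasible_contains_ellipsoid[OF feas] by blast
    show "\<forall>x. (\<forall>j\<in>S. ip n (a j) x \<le> \<beta> j) \<longrightarrow>
      (\<exists>v. ip n v v \<le> 1 \<and> (\<forall>i<n. x i = z i + W * mv n T v i))"
      by (intro allI impI ball) blast
  qed
qed

end

text \<open>The normal is \<open>x - y\<close> for the point \<open>y\<close> of \<open>C\<close>
  nearest to \<open>x\<close>, and the hyperplane passes halfway between them.\<close>

lemma compact_convex_separation:
  assumes "compact C" "convex_fun C" "C \<noteq> {}" and C: "\<And>y i. y \<in> C \<Longrightarrow> n \<le> i \<Longrightarrow> y i = 0"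
    and x: "x \<notin> C" "\<And>i. n \<le> i \<Longrightarrow> x i = 0"
  obtains a \<beta> where "\<And>y. y \<in> C \<Longrightarrow> ip n a y < \<beta>" "\<beta> < ip n a x"
proof -
  define f where "f y = ip n (\<lambda>i. y i - x i) (\<lambda>i. y i - x i)" for y
  have "continuous_on C f" unfolding f_def ip_def
    by (intro continuous_intros continuous_on_product_then_coordinatewise[OF continuous_on_id])
  then obtain y where y: "y \<in> C" "\<And>v. v \<in> C \<Longrightarrow> f y \<le> f v"
    using continuous_attains_inf[OF assms(1,3), of f] by blast
  define a where "a i = x i - y i" for i
  have fy: "f y = ip n a a" unfolding f_def a_def ip_def by (rule sum.cong) (auto simp: algebra_simps)
  have pos: "0 < ip n a a"
  proof (rule ccontr)
    assume "\<not> 0 < ip n a a"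
    then have "ip n a a = 0" using ip_self_nonneg[of n a] by linarith
    then have "x i = y i" for i
      using C[OF y(1), of i] x(2)[of i] by (cases "i < n") (auto simp: ip_self_eq_0 a_def)
    then show False using x(1) y(1) by (metis ext)
  qed
  have le: "ip n a v \<le> ip n a y" if v: "v \<in> C" for v
  proof (rule ccontr)
    assume nle: "\<not> ip n a v \<le> ip n a y"
    define h where "h i = v i - y i" for i
    define g where "g = ip n a h"
    define q where "q = ip n h h"
    have g: "0 < g" using nle by (simp add: g_def h_def[abs_def] ip_diff_right)
    have q: "0 \<le> q" by (simp add: q_def)
    \<comment> \<open>Moving from \<open>y\<close> to \<open>y + t h\<close> lowers the squared
      distance by \<open>t * (2 * g - t * q)\<close>. This \<open>t\<close> makes the bracket
      positive, against minimality; the \<open>+ 1\<close> covers \<open>q = 0\<close>.\<close>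
    define t where "t = min 1 (g / (q + 1))"
    have t: "0 < t" "t \<le> 1" using g q by (auto simp: t_def)
    have "t \<le> g / (q + 1)" by (simp add: t_def)
    then have "t * (q + 1) \<le> g" using q by (simp add: pos_le_divide_eq)
    then have tq: "t * q < 2 * g" using t g by (simp add: distrib_left)
    have "(\<lambda>i. (1 - t) * y i + t * v i) \<in> C"
      using assms(2) y(1) v t unfolding convex_fun_def by simp
    then have "f y \<le> f (\<lambda>i. (1 - t) * y i + t * v i)" by (rule y(2))
    also have "\<dots> = ip n (\<lambda>i. t * h i - a i) (\<lambda>i. t * h i - a i)"
      unfolding f_def by (rule ip_cong) (auto simp: h_def a_def algebra_simps)
    also have "\<dots> = f y - t * (2 * g - t * q)"
      by (simp add: fy ip_linear g_def q_def ip_commute[of n h a] algebra_simps)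
    finally have "t * (2 * g - t * q) \<le> 0" by simp
    then show False using t tq by (simp add: mult_le_0_iff)
  qed
  have ax: "ip n a x = ip n a y + ip n a a" by (simp add: a_def[abs_def] ip_linear)
  show ?thesis
  proof (rule that[of a "ip n a y + ip n a a / 2"])
    show "ip n a v < ip n a y + ip n a a / 2" if "v \<in> C" for v using le[OF that] pos by linarith
    show "ip n a y + ip n a a / 2 < ip n a x" using ax pos by linarith
  qed
qed

section \<open>Compactness in the product topology and approximation by polytopes\<close>

lemma compact_imp_coordinates_bounded:
  fixes C :: "(nat \<Rightarrow> real) set"
  assumes "compact C"
  obtains R where "\<And>y i. y \<in> C \<Longrightarrow> i < n \<Longrightarrow> \<bar>y i\<bar> < R"
proof -
  have "\<exists>B. \<forall>y\<in>C. \<bar>y i\<bar> \<le> B" for i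
  proof -
    have "compact ((\<lambda>y. y i) ` C)"
      by (intro compact_continuous_image assms continuous_on_product_then_coordinatewise[OF continuous_on_id])
    then have "bounded ((\<lambda>y. y i) ` C)" by (rule compact_imp_bounded)
    then show ?thesis unfolding bounded_iff real_norm_def by blast
  qed
  then obtain B where B: "\<And>i y. y \<in> C \<Longrightarrow> \<bar>y i\<bar> \<le> B i" by metis
  show ?thesis
  proof (rule that)
    fix y i assume "y \<in> C" "i < n"
    have "\<bar>y i\<bar> \<le> \<bar>B i\<bar>" using B[OF \<open>y \<in> C\<close>, of i] by linarith
    also have "\<dots> \<le> (\<Sum>k<n. \<bar>B k\<bar>)" using \<open>i < n\<close> by (intro member_le_sum) auto
    finally show "\<bar>y i\<bar> < 1 + (\<Sum>k<n. \<bar>B k\<bar>)" by simp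
  qed
qed

lemma compact_box: "compact {x :: nat \<Rightarrow> real. (\<forall>i<n. \<bar>x i\<bar> \<le> b i) \<and> (\<forall>i\<ge>n. x i = 0)}"
proof -
  have *: "x i \<in> (if i < n then {- b i..b i} else {0}) \<longleftrightarrow>
      (i < n \<longrightarrow> \<bar>x i\<bar> \<le> b i) \<and> (n \<le> i \<longrightarrow> x i = 0)" for x i
    by (cases "i < n") (auto simp: abs_le_iff)
  have "compact {x :: nat \<Rightarrow> real. \<forall>i. x i \<in> (if i < n then {- b i..b i} else {0})}"
    by (rule compact_coordinatewise) auto
  then show ?thesis unfolding * by (simp add: all_conj_distrib)
qed

lemma open_nbhd: "open {x. \<exists>y\<in>P. ip n (\<lambda>i. x i - y i) (\<lambda>i. x i - y i) < r}"
proof -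
  have "open {x. ip n (\<lambda>i. x i - y i) (\<lambda>i. x i - y i) < r}" for y
    unfolding ip_def
    by (intro open_Collect_less continuous_intros continuous_on_product_then_coordinatewise[OF continuous_on_id])
  then have "open (\<Union>y\<in>P. {x. ip n (\<lambda>i. x i - y i) (\<lambda>i. x i - y i) < r})" by blast
  also have "(\<Union>y\<in>P. {x. ip n (\<lambda>i. x i - y i) (\<lambda>i. x i - y i) < r})
      = {x. \<exists>y\<in>P. ip n (\<lambda>i. x i - y i) (\<lambda>i. x i - y i) < r}" by blast
  finally show ?thesis .
qed

text \<open>A box minus the open neighbourhood is compact, so finitely many separating half-spaces
  cut it off. An index is a triple of a member of \<open>I\<close>, a normal and a level: each
  half-space remembers a body that it contains. The radius \<open>r\<close> is a squared
  distance.\<close>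

lemma polytope_approximation:
  fixes C :: "'c \<Rightarrow> (nat \<Rightarrow> real) set"
  assumes "0 < n" "I \<noteq> {}"
    and C: "\<And>i. i \<in> I \<Longrightarrow> compact (C i)" "\<And>i. i \<in> I \<Longrightarrow> convex_fun (C i)"
      "\<And>i. i \<in> I \<Longrightarrow> C i \<subseteq> {y. \<forall>k\<ge>n. y k = 0}"
    and P: "p \<in> (\<Inter>i\<in>I. C i)" and r: "0 < r"
  obtains J :: "('c \<times> (nat \<Rightarrow> real) \<times> real) set" and R where
    "polytope n J (\<lambda>j. fst (snd j)) (\<lambda>j. snd (snd j)) R p"
    "\<forall>j\<in>J. fst j \<in> I \<and> (\<forall>y\<in>C (fst j). ip n (fst (snd j)) y \<le> snd (snd j))"
    "\<forall>x. (\<forall>j\<in>J. ip n (fst (snd j)) x \<le> snd (snd j)) \<longrightarrow> (\<forall>i\<ge>n. x i = 0) \<longrightarrow>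
      (\<exists>y\<in>(\<Inter>i\<in>I. C i). ip n (\<lambda>i. x i - y i) (\<lambda>i. x i - y i) < r)"
proof -
  let ?P = "\<Inter>i\<in>I. C i"
  let ?U = "{x. \<exists>y\<in>?P. ip n (\<lambda>i. x i - y i) (\<lambda>i. x i - y i) < r}"
  obtain i0 where i0: "i0 \<in> I" using assms(2) by blast
  obtain R where R: "\<And>y i. y \<in> C i0 \<Longrightarrow> i < n \<Longrightarrow> \<bar>y i\<bar> < R"
    using compact_imp_coordinates_bounded[OF C(1)[OF i0]] by blast
  define \<T> where "\<T> = {j :: 'c \<times> (nat \<Rightarrow> real) \<times> real. fst j \<in> I \<and> (\<forall>y\<in>C (fst j). ip n (fst (snd j)) y < snd (snd j))}"
  define V where "V j = {x. snd (snd j) < ip n (fst (snd j)) x}" for j :: "'c \<times> (nat \<Rightarrow> real) \<times> real"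
  define K where "K = {x :: nat \<Rightarrow> real. (\<forall>i<n. \<bar>x i\<bar> \<le> R) \<and> (\<forall>i\<ge>n. x i = 0)} - ?U"
  have "compact K" unfolding K_def by (rule compact_diff[OF compact_box open_nbhd])
  moreover have "open (V j)" for j
    unfolding V_def ip_def
    by (intro open_Collect_less continuous_intros continuous_on_product_then_coordinatewise[OF continuous_on_id])
  moreover have "K \<subseteq> (\<Union>j\<in>\<T>. V j)"
  proof
    fix x assume x: "x \<in> K"
    have "x \<notin> ?P"
    proof
      assume "x \<in> ?P"
      then have "x \<in> ?U" using r by (intro CollectI bexI[of _ x]) (auto simp: ip_def)
      then show False using x by (simp add: K_def)
    qed
    then obtain i where i: "i \<in> I" "x \<notin> C i" by blast
    have ne: "C i \<noteq> {}" using P i by blast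
    obtain a \<beta> where ab: "\<And>y. y \<in> C i \<Longrightarrow> ip n a y < \<beta>" "\<beta> < ip n a x"
    proof (rule compact_convex_separation[of "C i" n x])
      show "x k = 0" if "n \<le> k" for k using x that by (simp add: K_def)
    qed (use C i ne in blast)+
    then have "(i, a, \<beta>) \<in> \<T>" "x \<in> V (i, a, \<beta>)" using i by (auto simp: \<T>_def V_def)
    then show "x \<in> (\<Union>j\<in>\<T>. V j)" by blast
  qed
  ultimately obtain \<F> where F: "\<F> \<subseteq> \<T>" "finite \<F>" "K \<subseteq> (\<Union>j\<in>\<F>. V j)"
    using compactE_image[of K \<T> V] by metis
  have minus: "ip n (\<lambda>k. - unit_vec i k) x = - ip n (unit_vec i) x" for i x
    by (simp add: ip_def sum_negf)
  \<comment> \<open>The faces of the box make the polytope bounded. They contain \<open>C i0\<close>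
    strictly by the choice of \<open>R\<close>, so they are charged to \<open>i0\<close>.\<close>
  define B where "B = (\<lambda>i. (i0, unit_vec i, R)) ` {..<n} \<union> (\<lambda>i. (i0, \<lambda>k. - unit_vec i k, R)) ` {..<n}"
  have B: "B \<subseteq> \<T>" "finite B"
    using i0 R by (auto simp: B_def \<T>_def minus ip_unit_vec abs_less_iff)
  let ?J = "\<F> \<union> B"
  have J: "?J \<subseteq> \<T>" using F B by blast
  have box: "\<bar>x i\<bar> \<le> R" if x: "\<And>j. j \<in> ?J \<Longrightarrow> ip n (fst (snd j)) x \<le> snd (snd j)" and "i < n" for x i
  proof -
    have "(i0, unit_vec i, R) \<in> ?J" "(i0, \<lambda>k. - unit_vec i k, R) \<in> ?J"
      using \<open>i < n\<close> by (auto simp: B_def)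
    then have "ip n (unit_vec i) x \<le> R" "ip n (\<lambda>k. - unit_vec i k) x \<le> R"
      using x by fastforce+
    then show ?thesis unfolding minus using \<open>i < n\<close> by (simp add: ip_unit_vec abs_le_iff)
  qed
  show ?thesis
  proof (rule that[of ?J R])
    show "polytope n ?J (\<lambda>j. fst (snd j)) (\<lambda>j. snd (snd j)) R p"
    proof
      show "ip n (fst (snd j)) p < snd (snd j)" if "j \<in> ?J" for j
        using that J P by (auto simp: \<T>_def)
    qed (use assms(1) F B box in auto)
    show "\<forall>j\<in>?J. fst j \<in> I \<and> (\<forall>y\<in>C (fst j). ip n (fst (snd j)) y \<le> snd (snd j))"
      using J by (auto simp: \<T>_def less_imp_le)
  next
    show "\<forall>x. (\<forall>j\<in>?J. ip n (fst (snd j)) x \<le> snd (snd j)) \<longrightarrow> (\<forall>i\<ge>n. x i = 0) \<longrightarrow>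
      (\<exists>y\<in>?P. ip n (\<lambda>i. x i - y i) (\<lambda>i. x i - y i) < r)"
    proof (intro allI impI)
      fix x assume x: "\<forall>j\<in>?J. ip n (fst (snd j)) x \<le> snd (snd j)" "\<forall>i\<ge>n. x i = 0"
      have "x \<notin> K"
      proof
        assume "x \<in> K"
        then obtain j where "j \<in> \<F>" "x \<in> V j" using F by blast
        then show False using x(1) by (force simp: V_def)
      qed
      then show "\<exists>y\<in>?P. ip n (\<lambda>i. x i - y i) (\<lambda>i. x i - y i) < r"
        using box x unfolding K_def by blast
    qed
  qed
qed

section \<open>The Helly-type bounds\<close>

lemma eucl_dist_ip: "eucl_dist n x y = sqrt (ip n (\<lambda>i. x i - y i) (\<lambda>i. x i - y i))"
  by (simp add: eucl_dist_def ip_def power2_eq_square)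

lemma eucl_dist_L2_set: "eucl_dist n x y = L2_set (\<lambda>i. x i - y i) {..<n}"
  by (simp add: eucl_dist_def L2_set_def)

lemma eucl_dist_commute: "eucl_dist n x y = eucl_dist n y x"
  by (simp add: eucl_dist_def power2_commute)

lemma eucl_dist_triangle: "eucl_dist n x z \<le> eucl_dist n x y + eucl_dist n y z"
proof -
  have "eucl_dist n x z = L2_set (\<lambda>i. (x i - y i) + (y i - z i)) {..<n}"
    by (simp add: eucl_dist_L2_set)
  also have "\<dots> \<le> eucl_dist n x y + eucl_dist n y z"
    unfolding eucl_dist_L2_set by (rule L2_set_triangle_ineq)
  finally show ?thesis .
qed

lemma convex_body_facts:
  assumes "convex_body n A"
  shows "compact A" "convex_fun A" "\<And>y i. y \<in> A \<Longrightarrow> n \<le> i \<Longrightarrow> y i = 0"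
proof -
  have "compactin (subtopology (powertop_real UNIV) {x. \<forall>i\<ge>n. x i = 0}) A"
    using assms by (simp add: convex_body_def Euclidean_space_def)
  then have "compactin (powertop_real UNIV) A" and sub: "A \<subseteq> {x. \<forall>i\<ge>n. x i = 0}"
    by (simp_all add: compactin_subtopology)
  then show "compact A" by (simp add: euclidean_product_topology)
  show "\<And>y i. y \<in> A \<Longrightarrow> n \<le> i \<Longrightarrow> y i = 0" using sub by blast
  show "convex_fun A" using assms by (simp add: convex_body_def)
qed

text \<open>Points of the space at distance less than one from \<open>p\<close> lie in a compact
  box. On the part of the box outside \<open>U\<close> the squared distance to \<open>p\<close> has
  a positive minimum, which yields the squared radius \<open>r\<close>.\<close>

lemma interior_contains_ball:
  assumes "p \<in> Euclidean_space n interior_of P"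
  obtains r where "0 < r" "\<And>x. (\<And>i. n \<le> i \<Longrightarrow> x i = 0) \<Longrightarrow>
    ip n (\<lambda>i. x i - p i) (\<lambda>i. x i - p i) < r \<Longrightarrow> x \<in> P"
proof -
  obtain V where V: "openin (Euclidean_space n) V" "p \<in> V" "V \<subseteq> P"
    using assms unfolding interior_of_def by blast
  then obtain U where U: "open U" "V = U \<inter> {x. \<forall>i\<ge>n. x i = 0}"
    by (auto simp: Euclidean_space_def openin_subtopology euclidean_product_topology)
  define f where "f x = ip n (\<lambda>i. x i - p i) (\<lambda>i. x i - p i)" for x
  define K where "K = {x :: nat \<Rightarrow> real. (\<forall>i<n. \<bar>x i\<bar> \<le> \<bar>p i\<bar> + 1) \<and> (\<forall>i\<ge>n. x i = 0)} - U"
  have K: "compact K" unfolding K_def by (rule compact_diff[OF compact_box U(1)])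
  have box: "x \<in> U" if x: "\<And>i. n \<le> i \<Longrightarrow> x i = 0" "f x < 1" "x \<notin> K" for x
  proof -
    have "\<bar>x i\<bar> \<le> \<bar>p i\<bar> + 1" if "i < n" for i
    proof -
      have "(x i - p i)\<^sup>2 \<le> f x"
        unfolding f_def ip_def power2_eq_square using that
        by (intro member_le_sum[of i "{..<n}" "\<lambda>i. (x i - p i) * (x i - p i)"]) auto
      then have "(x i - p i)\<^sup>2 < 1" using x(2) by simp
      then have "\<bar>x i - p i\<bar> < 1" by (simp add: abs_square_less_1)
      then show ?thesis by linarith
    qed
    then show ?thesis using x by (auto simp: K_def)
  qed
  show ?thesis
  proof (cases "K = {}")
    case True
    show ?thesis
    proof (rule that[of 1])
      fix x assume "\<And>i. n \<le> i \<Longrightarrow> x i = 0" "ip n (\<lambda>i. x i - p i) (\<lambda>i. x i - p i) < 1"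
      then show "x \<in> P" using box[of x] True U V unfolding f_def by blast
    qed simp
  next
    case False
    have "continuous_on K f" unfolding f_def ip_def
      by (intro continuous_intros continuous_on_product_then_coordinatewise[OF continuous_on_id])
    then obtain y where y: "y \<in> K" "\<And>x. x \<in> K \<Longrightarrow> f y \<le> f x"
      using continuous_attains_inf[OF K False] by blast
    have "f y \<noteq> 0"
    proof
      assume "f y = 0"
      then have "\<forall>i<n. y i = p i" by (simp add: f_def ip_self_eq_0)
      moreover have "\<forall>i\<ge>n. y i = 0" "\<forall>i\<ge>n. p i = 0" using y U V by (auto simp: K_def)
      ultimately have "y i = p i" for i by (cases "i < n") auto
      then have "y = p" by blast
      then show False using y U V by (auto simp: K_def)
    qed
    moreover have "0 \<le> f y" by (simp add: f_def)
    ultimately have fy: "0 < f y" by simp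
    show ?thesis
    proof (rule that[of "min 1 (f y)"])
      fix x assume x: "\<And>i. n \<le> i \<Longrightarrow> x i = 0" "ip n (\<lambda>i. x i - p i) (\<lambda>i. x i - p i) < min 1 (f y)"
      then have "f x < 1" "f x < f y" by (auto simp: f_def)
      then have "x \<notin> K" using y(2) by force
      then show "x \<in> P" using box[OF x(1) \<open>f x < 1\<close>] x(1) U V by blast
    qed (use fy in simp)
  qed
qed

text \<open>Each selected half-space is replaced by the body it is charged to, so these bodies
  intersect inside the outer ellipsoid. The inner ellipsoid is only close to the full
  intersection.\<close>

lemma sparse_subfamily:
  fixes C :: "'c \<Rightarrow> (nat \<Rightarrow> real) set"
  assumes "0 < n" "finite I" "I \<noteq> {}" and body: "\<And>i. i \<in> I \<Longrightarrow> convex_body n (C i)"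
    and p: "p \<in> (\<Inter>i\<in>I. C i)" and r: "0 < r" and s: "32 * n \<le> s"
    and W: "W = 16 * real n + 32 * (real n)\<^sup>2 * sqrt (2 * real s) / real s"
  obtains F z T where "F \<subseteq> I" "F \<noteq> {}" "card F \<le> s + n + 1" "\<forall>i\<ge>n. z i = 0"
    "\<forall>i\<ge>n. \<forall>k. T i k = 0"
    "\<forall>v. ip n v v \<le> 1 \<longrightarrow> (\<exists>y\<in>(\<Inter>i\<in>I. C i).
      ip n (\<lambda>i. z i + mv n T v i - y i) (\<lambda>i. z i + mv n T v i - y i) < r)"
    "\<forall>x\<in>(\<Inter>i\<in>F. C i). \<exists>v. ip n v v \<le> 1 \<and> x = (\<lambda>i. z i + W * mv n T v i)"
proof -
  have C: "\<And>i. i \<in> I \<Longrightarrow> compact (C i)" "\<And>i. i \<in> I \<Longrightarrow> convex_fun (C i)"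
      "\<And>i. i \<in> I \<Longrightarrow> C i \<subseteq> {y. \<forall>k\<ge>n. y k = 0}"
    using convex_body_facts[OF body] by blast+
  obtain J :: "('c \<times> (nat \<Rightarrow> real) \<times> real) set" and R
    where poly: "polytope n J (\<lambda>j. fst (snd j)) (\<lambda>j. snd (snd j)) R p"
    and J: "\<forall>j\<in>J. fst j \<in> I \<and> (\<forall>y\<in>C (fst j). ip n (fst (snd j)) y \<le> snd (snd j))"
    and near: "\<forall>x. (\<forall>j\<in>J. ip n (fst (snd j)) x \<le> snd (snd j)) \<longrightarrow> (\<forall>i\<ge>n. x i = 0) \<longrightarrow>
      (\<exists>y\<in>(\<Inter>i\<in>I. C i). ip n (\<lambda>i. x i - y i) (\<lambda>i. x i - y i) < r)"
    by (rule polytope_approximation[OF assms(1,3) C p r])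
  obtain S T z where S: "S \<subseteq> J" "S \<noteq> {}" "card S \<le> s + n + 1"
    and z: "\<forall>i\<ge>n. z i = 0" and T: "\<forall>i\<ge>n. \<forall>k. T i k = 0"
    and inner: "\<forall>v. ip n v v \<le> 1 \<longrightarrow> (\<forall>j\<in>J. ip n (fst (snd j)) (\<lambda>i. z i + mv n T v i) \<le> snd (snd j))"
    and outer: "\<forall>x. (\<forall>j\<in>S. ip n (fst (snd j)) x \<le> snd (snd j)) \<longrightarrow>
      (\<exists>v. ip n v v \<le> 1 \<and> (\<forall>i<n. x i = z i + W * mv n T v i))"
    by (rule polytope.sparse_subpolytope[OF poly s W]) (rule that)
  have mT: "mv n T v i = 0" if "n \<le> i" for v i using T that by (simp add: mv_def)
  have fS: "finite S" using S polytope.fin[OF poly] by (metis finite_subset)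
  show ?thesis
  proof (rule that[of "fst ` S" z T])
    show "fst ` S \<subseteq> I" using S J by auto
    show "fst ` S \<noteq> {}" using S by simp
    show "card (fst ` S) \<le> s + n + 1" using card_image_le[OF fS, of fst] S by linarith
    show "\<forall>v. ip n v v \<le> 1 \<longrightarrow> (\<exists>y\<in>(\<Inter>i\<in>I. C i).
      ip n (\<lambda>i. z i + mv n T v i - y i) (\<lambda>i. z i + mv n T v i - y i) < r)"
    proof (intro allI impI)
      fix v assume v: "ip n v v \<le> 1"
      have "\<forall>j\<in>J. ip n (fst (snd j)) (\<lambda>i. z i + mv n T v i) \<le> snd (snd j)" using inner v by blast
      moreover have "\<forall>i\<ge>n. z i + mv n T v i = 0" using z mT by simp
      ultimately show "\<exists>y\<in>(\<Inter>i\<in>I. C i).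
        ip n (\<lambda>i. z i + mv n T v i - y i) (\<lambda>i. z i + mv n T v i - y i) < r"
        using near[THEN spec, of "\<lambda>i. z i + mv n T v i"] by blast
    qed
    show "\<forall>x\<in>(\<Inter>i\<in>fst ` S. C i). \<exists>v. ip n v v \<le> 1 \<and> x = (\<lambda>i. z i + W * mv n T v i)"
    proof
      fix x assume x: "x \<in> (\<Inter>i\<in>fst ` S. C i)"
      have "\<forall>j\<in>S. ip n (fst (snd j)) x \<le> snd (snd j)" using x S J by blast
      then obtain v where v: "ip n v v \<le> 1" "\<forall>i<n. x i = z i + W * mv n T v i"
        using outer by blast
      \<comment> \<open>Membership in one body of the subfamily makes the coordinates of
        \<open>x\<close> from \<open>n\<close> on vanish.\<close>
      obtain j where "j \<in> S" using S by blast
      then have "x \<in> C (fst j)" "fst j \<in> I" using x S J by blast+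
      then have x0: "\<forall>i\<ge>n. x i = 0" using C(3) by blast
      have "x i = z i + W * mv n T v i" for i
        using v(2) z mT x0 by (cases "i < n") auto
      then show "\<exists>v. ip n v v \<le> 1 \<and> x = (\<lambda>i. z i + W * mv n T v i)" using v(1) by blast
    qed
  qed (use z T in auto)
qed

text \<open>Averaging with a small ball about \<open>p\<close> absorbs the approximation error: the
  inner ellipsoid, halved and moved to the center \<open>q\<close>, lies in the intersection.
  Halving turns the ratio \<open>W\<close> into \<open>2 * W\<close>.\<close>

lemma homothet_bound:
  fixes C :: "'c \<Rightarrow> (nat \<Rightarrow> real) set"
  assumes "0 < n" "finite I" "I \<noteq> {}" and body: "\<And>i. i \<in> I \<Longrightarrow> convex_body n (C i)"
    and int: "Euclidean_space n interior_of (\<Inter>i\<in>I. C i) \<noteq> {}" and s: "32 * n \<le> s"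
    and W: "W = 16 * real n + 32 * (real n)\<^sup>2 * sqrt (2 * real s) / real s" and L: "2 * W \<le> L"
  obtains F z where "F \<subseteq> I" "F \<noteq> {}" "card F \<le> s + n + 1" "z \<in> topspace (Euclidean_space n)"
    "translate z (\<Inter>i\<in>F. C i) \<subseteq> dilate L (translate z (\<Inter>i\<in>I. C i))"
proof -
  let ?P = "\<Inter>i\<in>I. C i"
  obtain p where p: "p \<in> Euclidean_space n interior_of ?P" using int by blast
  have pP: "p \<in> ?P" by (rule subsetD[OF interior_of_subset p])
  obtain r where r: "0 < r" and ball: "\<And>x. (\<And>i. n \<le> i \<Longrightarrow> x i = 0) \<Longrightarrow>
    ip n (\<lambda>i. x i - p i) (\<lambda>i. x i - p i) < r \<Longrightarrow> x \<in> ?P"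
    using interior_contains_ball[OF p] by blast
  have P0: "y i = 0" if "y \<in> ?P" "n \<le> i" for y i
    using convex_body_facts(3)[OF body] assms(3) that by blast
  have Pc: "(\<lambda>i. 1 / 2 * x i + 1 / 2 * y i) \<in> ?P" if "x \<in> ?P" "y \<in> ?P" for x y
  proof
    fix i assume "i \<in> I"
    then have "convex_fun (C i)" "x \<in> C i" "y \<in> C i"
      using convex_body_facts(2)[OF body] that by blast+
    moreover have "(0::real) \<le> 1 / 2" "1 / 2 + 1 / 2 = (1::real)" by simp_all
    ultimately show "(\<lambda>i. 1 / 2 * x i + 1 / 2 * y i) \<in> C i"
      unfolding convex_fun_def by blast
  qed
  obtain F T z where F: "F \<subseteq> I" "F \<noteq> {}" "card F \<le> s + n + 1"
    and z: "\<forall>i\<ge>n. z i = 0" and T0: "\<forall>i\<ge>n. \<forall>k. T i k = 0"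
    and inner: "\<forall>v. ip n v v \<le> 1 \<longrightarrow> (\<exists>y\<in>?P.
      ip n (\<lambda>i. z i + mv n T v i - y i) (\<lambda>i. z i + mv n T v i - y i) < r)"
    and outer: "\<forall>x\<in>(\<Inter>i\<in>F. C i). \<exists>v. ip n v v \<le> 1 \<and> x = (\<lambda>i. z i + W * mv n T v i)"
    by (rule sparse_subfamily[OF assms(1-3) body pP r s W]) (assumption | rule that)+
  have T: "mv n T v i = 0" if "n \<le> i" for v i using T0 that by (simp add: mv_def)
  have "1 \<le> real n" using assms(1) by simp
  then have "16 \<le> W" unfolding W by (intro order_trans[OF _ le_add_same_cancel1[THEN iffD2]]) auto
  then have W0: "0 < W" "1 < L" using L by auto
  define q where "q i = (p i + z i) / 2" for i
  \<comment> \<open>The solution of \<open>c + z = L * (c + q)\<close>, so that translation by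
    \<open>c\<close> aligns the two centers under dilation by \<open>L\<close>; \<open>L > 1\<close>
    because \<open>W \<ge> 16\<close>.\<close>
  define c where "c i = - (L * q i - z i) / (L - 1)" for i
  have half: "(\<lambda>i. q i + 1 / 2 * mv n T v i) \<in> ?P" if "ip n v v \<le> 1" for v
  proof -
    obtain y where y: "y \<in> ?P"
      "ip n (\<lambda>i. z i + mv n T v i - y i) (\<lambda>i. z i + mv n T v i - y i) < r"
      using inner \<open>ip n v v \<le> 1\<close> by blast
    \<comment> \<open>The error vector is short enough to be added to \<open>p\<close>; the midpoint
      of the result and \<open>y\<close> is \<open>q + T v / 2\<close>.\<close>
    have "(\<lambda>i. p i + (z i + mv n T v i - y i)) \<in> ?P"
    proof (rule ball)
      show "p i + (z i + mv n T v i - y i) = 0" if "n \<le> i" for i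
        using P0[OF pP that] P0[OF y(1) that] z that T[OF that] by simp
      show "ip n (\<lambda>i. p i + (z i + mv n T v i - y i) - p i) (\<lambda>i. p i + (z i + mv n T v i - y i) - p i) < r"
        using y(2) by simp
    qed
    then have "(\<lambda>i. 1 / 2 * (p i + (z i + mv n T v i - y i)) + 1 / 2 * y i) \<in> ?P" by (rule Pc[OF _ y(1)])
    moreover have "(\<lambda>i. 1 / 2 * (p i + (z i + mv n T v i - y i)) + 1 / 2 * y i) = (\<lambda>i. q i + 1 / 2 * mv n T v i)"
      by (rule ext) (simp add: q_def field_simps)
    ultimately show ?thesis by (simp only:)
  qed
  show ?thesis
  proof (rule that[OF F, of c])
    show "c \<in> topspace (Euclidean_space n)"
      using P0[OF pP] z by (simp add: topspace_Euclidean_space c_def q_def)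
    show "translate c (\<Inter>i\<in>F. C i) \<subseteq> dilate L (translate c ?P)"
    proof
      fix x' assume "x' \<in> translate c (\<Inter>i\<in>F. C i)"
      then obtain x where x: "x \<in> (\<Inter>i\<in>F. C i)" "x' = (\<lambda>i. c i + x i)"
        by (auto simp: translate_def)
      obtain v where v: "ip n v v \<le> 1" "x = (\<lambda>i. z i + W * mv n T v i)" using outer x(1) by blast
      define v' where "v' = (\<lambda>i. (2 * W / L) * v i)"
      have "2 * W / L \<le> 1" "0 \<le> 2 * W / L" using L W0 by auto
      then have k: "(2 * W / L) * (2 * W / L) \<le> 1" by (intro mult_le_one)
      have "ip n v' v' = ((2 * W / L) * (2 * W / L)) * ip n v v"
        unfolding v'_def ip_scale_left ip_scale_right by simp
      also have "\<dots> \<le> 1" by (rule mult_le_one[OF k ip_self_nonneg v(1)])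
      finally have y: "(\<lambda>i. q i + 1 / 2 * mv n T v' i) \<in> ?P" by (rule half)
      have x': "x' = (\<lambda>i. L * (c i + (q i + 1 / 2 * mv n T v' i)))"
      proof
        fix i
        have "L * (1 / 2 * mv n T v' i) = W * mv n T v i"
          unfolding v'_def mv_scale using W0 by simp
        moreover have "(L - 1) * c i = z i - L * q i" using W0 by (simp add: c_def)
        ultimately show "x' i = L * (c i + (q i + 1 / 2 * mv n T v' i))"
          unfolding x(2) v(2) by (simp only: distrib_left) (simp add: left_diff_distrib)
      qed
      have "(\<lambda>i. c i + (q i + 1 / 2 * mv n T v' i)) \<in> translate c ?P"
        unfolding translate_def by (rule image_eqI[OF refl y])
      then show "x' \<in> dilate L (translate c ?P)"
        unfolding dilate_def x' by (rule image_eqI[rotated]) (rule refl)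
    qed
  qed
qed

text \<open>With \<open>r = 1\<close>, points of the inner ellipsoid are within 1 of a set of
  diameter 1, so its diameter is at most 3, and that of the outer one at most
  \<open>3 * W\<close>.\<close>

lemma diameter_bound:
  fixes C :: "'c \<Rightarrow> (nat \<Rightarrow> real) set"
  assumes "0 < n" "finite I" "I \<noteq> {}" and body: "\<And>i. i \<in> I \<Longrightarrow> convex_body n (C i)"
    and diam: "eucl_diam n (\<Inter>i\<in>I. C i) = 1" and s: "32 * n \<le> s"
    and W: "W = 16 * real n + 32 * (real n)\<^sup>2 * sqrt (2 * real s) / real s"
  obtains F where "F \<subseteq> I" "F \<noteq> {}" "card F \<le> s + n + 1" "eucl_diam n (\<Inter>i\<in>F. C i) \<le> 3 * W"
proof -
  let ?P = "\<Inter>i\<in>I. C i"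
  have ne: "?P \<noteq> {}" using diam by (auto simp: eucl_diam_def split: if_splits)
  then obtain p where p: "p \<in> ?P" by blast
  have dP: "eucl_dist n x y \<le> 1" if "x \<in> ?P" "y \<in> ?P" for x y
  proof -
    obtain i0 where i0: "i0 \<in> I" using assms(3) by blast
    obtain R where R: "\<And>y i. y \<in> C i0 \<Longrightarrow> i < n \<Longrightarrow> \<bar>y i\<bar> < R"
      using compact_imp_coordinates_bounded[OF convex_body_facts(1)[OF body[OF i0]]] by blast
    \<comment> \<open>The supremum bounds each distance once boundedness is known; compactness of
      one body supplies it.\<close>
    have "bdd_above ((\<lambda>(x, y). eucl_dist n x y) ` (?P \<times> ?P))"
    proof (rule bdd_aboveI2)
      fix xy assume "xy \<in> ?P \<times> ?P"
      then have "fst xy \<in> C i0" "snd xy \<in> C i0" using i0 by auto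
      then have "eucl_dist n (fst xy) (snd xy) \<le> (\<Sum>i<n. 2 * R)"
        unfolding eucl_dist_L2_set
        by (intro order_trans[OF L2_set_le_sum_abs] sum_mono) (smt (verit) R lessThan_iff)
      then show "(\<lambda>(x, y). eucl_dist n x y) xy \<le> (\<Sum>i<n. 2 * R)" by (simp add: case_prod_unfold)
    qed
    then have "(\<lambda>(x, y). eucl_dist n x y) (x, y) \<le> (SUP (x, y)\<in>?P \<times> ?P. eucl_dist n x y)"
      using that by (intro cSUP_upper) auto
    then show ?thesis using diam ne by (simp add: eucl_diam_def)
  qed
  obtain F T z where F: "F \<subseteq> I" "F \<noteq> {}" "card F \<le> s + n + 1"
    and inner: "\<forall>v. ip n v v \<le> 1 \<longrightarrow> (\<exists>y\<in>?P.
      ip n (\<lambda>i. z i + mv n T v i - y i) (\<lambda>i. z i + mv n T v i - y i) < 1)"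
    and outer: "\<forall>x\<in>(\<Inter>i\<in>F. C i). \<exists>v. ip n v v \<le> 1 \<and> x = (\<lambda>i. z i + W * mv n T v i)"
    by (rule sparse_subfamily[OF assms(1-3) body p zero_less_one s W]) (assumption | rule that)+
  have W0: "0 \<le> W" unfolding W by simp
  have inner': "\<exists>y\<in>?P. eucl_dist n (\<lambda>i. z i + mv n T v i) y \<le> 1" if "ip n v v \<le> 1" for v
    using inner that unfolding eucl_dist_ip by (force simp: less_imp_le)
  have dS: "eucl_dist n x x' \<le> 3 * W" if x: "x \<in> (\<Inter>i\<in>F. C i)" "x' \<in> (\<Inter>i\<in>F. C i)" for x x'
  proof -
    obtain v where v: "ip n v v \<le> 1" "x = (\<lambda>i. z i + W * mv n T v i)"
      using outer x(1) by blast
    obtain v' where v': "ip n v' v' \<le> 1" "x' = (\<lambda>i. z i + W * mv n T v' i)"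
      using outer x(2) by blast
    let ?e = "\<lambda>i. z i + mv n T v i" and ?e' = "\<lambda>i. z i + mv n T v' i"
    obtain y y' where y: "y \<in> ?P" "eucl_dist n ?e y \<le> 1" "y' \<in> ?P" "eucl_dist n ?e' y' \<le> 1"
      using inner'[OF v(1)] inner'[OF v'(1)] by blast
    have "eucl_dist n ?e ?e' \<le> eucl_dist n ?e y + (eucl_dist n y y' + eucl_dist n y' ?e')"
      using eucl_dist_triangle[of n ?e ?e' y] eucl_dist_triangle[of n y ?e' y'] by linarith
    also have "\<dots> \<le> 3" using y dP[OF y(1,3)] eucl_dist_commute[of n ?e' y'] by linarith
    finally have 3: "eucl_dist n ?e ?e' \<le> 3" .
    have "eucl_dist n x x' = W * eucl_dist n ?e ?e'"
      unfolding v(2) v'(2) eucl_dist_L2_set L2_set_right_distrib[OF W0]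
      by (rule L2_set_cong) (auto simp: right_diff_distrib)
    also have "\<dots> \<le> W * 3" by (rule mult_left_mono[OF 3 W0])
    finally show ?thesis by simp
  qed
  have "?P \<subseteq> (\<Inter>i\<in>F. C i)" using F(1) by blast
  then have "(\<Inter>i\<in>F. C i) \<noteq> {}" using ne by blast
  then have "eucl_diam n (\<Inter>i\<in>F. C i) \<le> 3 * W"
    unfolding eucl_diam_def using dS by (auto intro!: cSUP_least)
  then show ?thesis using that F by blast
qed

text \<open>The root of \<open>2 / s\<close> is at most \<open>n powr (- \<delta> / 2) / 4\<close>,
  so the second term of the radius is at most 8 times the target power. Also \<open>n\<close> is at
  most \<open>n powr \<delta>\<close> and \<open>n powr (2 - \<delta> / 2)\<close>, by
  \<open>1 \<le> \<delta>\<close> and \<open>\<delta> \<le> 2\<close>.\<close>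

lemma sample_size_bounds:
  fixes \<delta> :: real
  assumes "0 < n" "1 \<le> \<delta>" "\<delta> \<le> 2"
  defines "s \<equiv> nat \<lceil>32 * real n powr \<delta>\<rceil>"
  shows "32 * n \<le> s" "real (s + n + 1) \<le> 35 * real n powr \<delta>"
    "16 * real n + 32 * (real n)\<^sup>2 * sqrt (2 * real s) / real s \<le> 24 * real n powr (2 - \<delta> / 2)"
proof -
  have n: "1 \<le> real n" using assms(1) by simp
  have pow: "real n \<le> real n powr \<delta>" "1 \<le> real n powr \<delta>"
    using powr_mono[OF assms(2) n] n by auto
  have s: "32 * real n powr \<delta> \<le> real s" "real s \<le> 32 * real n powr \<delta> + 1"
    unfolding s_def using pow(2) by (auto simp: of_nat_nat intro: less_imp_le)
  then have "real (32 * n) \<le> real s" using pow(1) by simp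
  then show "32 * n \<le> s" by (simp only: of_nat_le_iff)
  show "real (s + n + 1) \<le> 35 * real n powr \<delta>" using s pow by simp
  have s0: "0 < real s" using s(1) pow(2) by linarith
  have "sqrt (2 * real s) / real s \<le> 1 / 4 * real n powr (- \<delta> / 2)"
  proof -
    have "(sqrt (2 * real s) / real s)\<^sup>2 = 2 / real s"
      using s0 by (simp add: power_divide power2_eq_square)
    also have "\<dots> \<le> 2 / (32 * real n powr \<delta>)"
      using s(1) s0 pow(2) assms(1) by (intro divide_left_mono mult_pos_pos) auto
    also have "\<dots> = (1 / 4 * real n powr (- \<delta> / 2))\<^sup>2"
      using n by (simp add: power2_eq_square powr_minus_divide flip: powr_add)
    finally show ?thesis by (rule power2_le_imp_le) simp
  qed
  then have "32 * (real n)\<^sup>2 * (sqrt (2 * real s) / real s)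
      \<le> 32 * (real n)\<^sup>2 * (1 / 4 * real n powr (- \<delta> / 2))"
    by (rule mult_left_mono) simp
  also have "\<dots> = 8 * real n powr (2 - \<delta> / 2)"
    using powr_add[of "real n" 2 "- \<delta> / 2"] n by (simp add: powr_numeral)
  finally have "32 * (real n)\<^sup>2 * sqrt (2 * real s) / real s \<le> 8 * real n powr (2 - \<delta> / 2)" by simp
  moreover have "real n \<le> real n powr (2 - \<delta> / 2)"
    using powr_mono[of 1 "2 - \<delta> / 2" "real n"] assms(3) n by simp
  ultimately show "16 * real n + 32 * (real n)\<^sup>2 * sqrt (2 * real s) / real s
      \<le> 24 * real n powr (2 - \<delta> / 2)" by linarith
qed

lemma enumerate_finite_Inter:
  fixes F :: "'a set"
  assumes "finite F"
  obtains k where "\<And>j. j \<in> {1..card F} \<Longrightarrow> k j \<in> F" "(\<Inter>j\<in>{1..card F}. C (k j)) = (\<Inter>i\<in>F. C i)"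
proof -
  obtain k where k: "bij_betw k {1..card F} F" using ex_bij_betw_nat_finite_1[OF assms] by blast
  then have "F = k ` {1..card F}" by (simp add: bij_betw_imp_surj_on)
  then have "(\<Inter>i\<in>F. C i) = (\<Inter>j\<in>{1..card F}. C (k j))" by (metis image_image)
  then show ?thesis using that[of k] k bij_betwE by metis
qed

theorem theorem1p4:
  shows "\<exists>\<alpha> c :: real. \<alpha> > 1 \<and> c > 0 \<and>
    (\<forall>\<delta> :: real. 1 \<le> \<delta> \<and> \<delta> \<le> 2 \<longrightarrow>
      (\<forall>(n :: nat) (I :: nat set) (C :: nat \<Rightarrow> (nat \<Rightarrow> real) set).
          n \<ge> 1 \<and> finite I \<and> I \<noteq> {} \<and> (\<forall>i\<in>I. convex_body n (C i)) \<and>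
          Euclidean_space n interior_of (\<Inter>i\<in>I. C i) \<noteq> {} \<longrightarrow>
          (\<exists>z \<in> topspace (Euclidean_space n). \<exists>(s :: nat) (k :: nat \<Rightarrow> nat).
             1 \<le> s \<and> real s \<le> \<alpha> * real n powr \<delta> \<and> (\<forall>j\<in>{1..s}. k j \<in> I) \<and>
             translate z (\<Inter>j\<in>{1..s}. C (k j))
               \<subseteq> dilate (c * real n powr (2 - \<delta> / 2)) (translate z (\<Inter>i\<in>I. C i)))) \<and>
      (\<forall>(n :: nat) (I :: nat set) (C :: nat \<Rightarrow> (nat \<Rightarrow> real) set).
          n \<ge> 1 \<and> finite I \<and> I \<noteq> {} \<and> (\<forall>i\<in>I. convex_body n (C i)) \<and>
          eucl_diam n (\<Inter>i\<in>I. C i) = 1 \<longrightarrow>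
          (\<exists>(s :: nat) (k :: nat \<Rightarrow> nat).
             1 \<le> s \<and> real s \<le> \<alpha> * real n powr \<delta> \<and> (\<forall>j\<in>{1..s}. k j \<in> I) \<and>
             eucl_diam n (\<Inter>j\<in>{1..s}. C (k j)) \<le> c * real n powr (2 - \<delta> / 2))))"
proof (rule exI[of _ 35], rule exI[of _ 72], intro conjI allI impI; (elim conjE)?)
  \<comment> \<open>The witness \<open>35\<close> bounds \<open>s + n + 1\<close>, and
    \<open>72\<close> is \<open>3 * 24\<close> from the diameter estimate, which also covers the
    ratio \<open>2 * 24\<close> of the homothety.\<close>
  fix \<delta> :: real and n :: nat and I :: "nat set" and C :: "nat \<Rightarrow> (nat \<Rightarrow> real) set"
  assume \<delta>: "1 \<le> \<delta>" "\<delta> \<le> 2" and n1: "1 \<le> n" and I: "finite I" "I \<noteq> {}"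
    and body: "\<forall>i\<in>I. convex_body n (C i)"
  then have n: "0 < n" by simp
  define s where "s = nat \<lceil>32 * real n powr \<delta>\<rceil>"
  define W where "W = 16 * real n + 32 * (real n)\<^sup>2 * sqrt (2 * real s) / real s"
  note bounds = sample_size_bounds[OF n \<delta>, folded s_def, folded W_def]
  have card: "1 \<le> card F \<and> real (card F) \<le> 35 * real n powr \<delta>"
    if "F \<subseteq> I" "F \<noteq> {}" "card F \<le> s + n + 1" for F
  proof
    show "1 \<le> card F" using that I by (metis One_nat_def Suc_leI card_gt_0_iff finite_subset)
    show "real (card F) \<le> 35 * real n powr \<delta>" using that(3) bounds(2) by linarith
  qed
  {
    assume int: "Euclidean_space n interior_of (\<Inter>i\<in>I. C i) \<noteq> {}"
    have "2 * W \<le> 72 * real n powr (2 - \<delta> / 2)" 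
      using bounds(3) powr_ge_zero[of "real n" "2 - \<delta> / 2"] by linarith
    then obtain F z where F: "F \<subseteq> I" "F \<noteq> {}" "card F \<le> s + n + 1"
      and z: "z \<in> topspace (Euclidean_space n)"
        "translate z (\<Inter>i\<in>F. C i)
          \<subseteq> dilate (72 * real n powr (2 - \<delta> / 2)) (translate z (\<Inter>i\<in>I. C i))"
      using homothet_bound[OF n I _ int bounds(1) W_def] body by metis
    obtain k where "\<And>j. j \<in> {1..card F} \<Longrightarrow> k j \<in> F"
      "(\<Inter>j\<in>{1..card F}. C (k j)) = (\<Inter>i\<in>F. C i)"
      using enumerate_finite_Inter[of F C] F(1) I(1) finite_subset by metis
    then show "\<exists>z \<in> topspace (Euclidean_space n). \<exists>(s :: nat) (k :: nat \<Rightarrow> nat).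
             1 \<le> s \<and> real s \<le> 35 * real n powr \<delta> \<and> (\<forall>j\<in>{1..s}. k j \<in> I) \<and>
             translate z (\<Inter>j\<in>{1..s}. C (k j))
               \<subseteq> dilate (72 * real n powr (2 - \<delta> / 2)) (translate z (\<Inter>i\<in>I. C i))"
      using card[OF F] F(1) z
      by (intro bexI[OF _ z(1)] exI[of _ "card F"] exI[of _ k]) auto
  next
    assume diam: "eucl_diam n (\<Inter>i\<in>I. C i) = 1"
    obtain F where F: "F \<subseteq> I" "F \<noteq> {}" "card F \<le> s + n + 1"
      and d: "eucl_diam n (\<Inter>i\<in>F. C i) \<le> 3 * W"
      using diameter_bound[OF n I _ diam bounds(1) W_def] body by metis
    obtain k where "\<And>j. j \<in> {1..card F} \<Longrightarrow> k j \<in> F"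
      "(\<Inter>j\<in>{1..card F}. C (k j)) = (\<Inter>i\<in>F. C i)"
      using enumerate_finite_Inter[of F C] F(1) I(1) finite_subset by metis
    moreover have "eucl_diam n (\<Inter>i\<in>F. C i) \<le> 72 * real n powr (2 - \<delta> / 2)"
      using d bounds(3) powr_ge_zero[of "real n" "2 - \<delta> / 2"] by linarith
    ultimately show "\<exists>(s :: nat) (k :: nat \<Rightarrow> nat).
             1 \<le> s \<and> real s \<le> 35 * real n powr \<delta> \<and> (\<forall>j\<in>{1..s}. k j \<in> I) \<and>
             eucl_diam n (\<Inter>j\<in>{1..s}. C (k j)) \<le> 72 * real n powr (2 - \<delta> / 2)"
      using card[OF F] F(1) by (intro exI[of _ "card F"] exI[of _ k]) auto
  }
qed simp_all

end
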